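(* Let $G$ be a group. The following are equivalent: (1) for any prime $p$, every connected component of the $p$-local commensurability graph $\Gamma_p(G)$ is complete; (2) all of the finite quotients of $G$ are nilpotent.
   Context: For a group $G$ and a prime $p$, the $p$-local commensurability graph $\Gamma_p(G)$ is the simple graph whose vertices are the finite-index subgroups of $G$, where two distinct vertices $A, B \leq G$ are adjacent if and only if $[A : A\cap B][B : A\cap B]$ is a power of $p$. A component is complete if any two distinct vertices in it are adjacent. *)

theory Defs
  imports
    "HOL-Algebra.Algebra"
    "HOL-Computational_Algebra.Primes"
    "Graph_Theory.Digraph_Component"
begin

section \<open>Nilpotent groups\<close>

primrec lower_central_series :: "('a, 'b) monoid_scheme \<Rightarrow> nat \<Rightarrow> 'a set" where
  "lower_central_series G 0 = carrier G"
| "lower_central_series G (Suc n) =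
     generate G {x \<otimes>\<^bsub>G\<^esub> y \<otimes>\<^bsub>G\<^esub> inv\<^bsub>G\<^esub> x \<otimes>\<^bsub>G\<^esub> inv\<^bsub>G\<^esub> y | x y.
                   x \<in> lower_central_series G n \<and> y \<in> carrier G}"

definition nilpotent :: "('a, 'b) monoid_scheme \<Rightarrow> bool" where
  "nilpotent G \<longleftrightarrow> (\<exists>n. lower_central_series G n = {\<one>\<^bsub>G\<^esub>})"

section \<open>The local commensurability graph\<close>

text \<open>For subgroups \<^term>\<open>H \<subseteq> A\<close> of \<^term>\<open>G\<close>, the index of \<^term>\<open>H\<close> in \<^term>\<open>A\<close>.
  An infinite index is represented by 0, which is not a power of a prime.\<close>

definition subgroup_index :: "('a, 'b) monoid_scheme \<Rightarrow> 'a set \<Rightarrow> 'a set \<Rightarrow> nat" where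
  "subgroup_index G A H = card (rcosets\<^bsub>G\<lparr>carrier := A\<rparr>\<^esub> H)"

definition finite_index_subgroups :: "('a, 'b) monoid_scheme \<Rightarrow> 'a set set" where
  "finite_index_subgroups G = {H. subgroup H G \<and> finite (rcosets\<^bsub>G\<^esub> H)}"

definition local_comm_graph :: "nat \<Rightarrow> ('a, 'b) monoid_scheme \<Rightarrow> 'a set pair_pre_digraph" where
  "local_comm_graph p G =
     \<lparr> pverts = finite_index_subgroups G,
       parcs = {(A, B). A \<in> finite_index_subgroups G \<and> B \<in> finite_index_subgroups G \<and> A \<noteq> B \<and>
                  (\<exists>k. subgroup_index G A (A \<inter> B) * subgroup_index G B (A \<inter> B) = p ^ k)} \<rparr>"

text \<open>A simple graph is a symmetric, loop-free digraph without parallel arcs. The locale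
  \<^locale>\<open>pair_graph\<close> is not available here, since it also requires finitely many vertices.\<close>

lemma local_comm_graph_bidirected: "pair_bidirected_digraph (local_comm_graph p G)"
  by unfold_locales
    (auto simp: local_comm_graph_def symmetric_def Int_commute mult.commute intro!: symI)

section \<open>Complete components\<close>

definition connected_components :: "('a, 'b) pre_digraph \<Rightarrow> ('a, 'b) pre_digraph set" where
  "connected_components D = {C. pre_digraph.max_subgraph D connected C}"

definition complete_graph :: "('a, 'b) pre_digraph \<Rightarrow> bool" where
  "complete_graph D \<longleftrightarrow> (\<forall>u \<in> verts D. \<forall>v \<in> verts D. u \<noteq> v \<longrightarrow> u \<rightarrow>\<^bsub>D\<^esub> v)"

end

theory Submission
  imports Defs
begin

text \<open>Call subgroups \<open>A\<close> and \<open>B\<close> \<open>p\<close>-commensurable if \<open>A \<inter> B\<close> has \<open>p\<close>-power index in both.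
Every component of the \<open>p\<close>-local commensurability graph is complete exactly when this
reflexive and symmetric relation is transitive on the subgroups of finite index. Three such
subgroups contain a common normal subgroup of finite index (the normal core of their
intersection), and indices of subgroups containing it can be read off in the quotient. So
both directions are statements about finite groups.

In a finite nilpotent group the \<open>p\<close>-commensurability class of a subgroup is determined by its
elements of order prime to \<open>p\<close>. If \<open>H \<subseteq> A\<close> has \<open>p\<close>-power index, then, normalizers growing in
nilpotent groups, \<open>H\<close> is reached from \<open>A\<close> by a chain of normal steps of \<open>p\<close>-power index, and an
element of order prime to \<open>p\<close> survives each step (\<open>nilpotent_p'_elements_mem\<close>). Conversely, by
Sylow's theorem, a subgroup of \<open>A\<close> containing all elements of \<open>A\<close> of \<open>q\<close>-power order has index
prime to \<open>q\<close> (\<open>prime_not_dvd_index\<close>). Transitivity follows.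

For the other direction let \<open>G\<close> be a finite group with transitive \<open>p\<close>-commensurability for all
\<open>p\<close>. Comparing \<open>A\<close>, \<open>C\<close>, \<open>B\<close> for \<open>A, B \<subseteq> C\<close> shows that subgroups of \<open>p\<close>-power index in a common
subgroup intersect in a subgroup of \<open>p\<close>-power index, and this property (\<open>p_index_closed\<close>) passes
to subgroups. By induction on the order all proper subgroups may be assumed to satisfy the
normalizer condition, that is, to have no proper self-normalizing subgroups. Suppose that some
maximal subgroup \<open>M\<close> is not normal. The counting argument behind the solubility of minimal
non-nilpotent groups yields at least some normal maximal subgroup \<open>N\<close>
(\<open>exists_normal_maximal_subgroup\<close>). A Sylow subgroup \<open>P\<close> of \<open>N\<close> not contained in \<open>M\<close> is normal in
\<open>G\<close>, so \<open>P M = G\<close> and \<open>M\<close> has \<open>p\<close>-power index. Intersecting its conjugates shows that \<open>M\<close>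
contains a normal subgroup \<open>K\<close> of \<open>p\<close>-power index. Now \<open>G / K\<close> is a \<open>p\<close>-group, in which normalizers
grow, so \<open>M\<close> is normal after all. Hence all maximal subgroups are normal, which gives the
normalizer condition for \<open>G\<close>, and a finite group with the normalizer condition is nilpotent
because every nontrivial quotient has a nontrivial center.\<close>

section \<open>Normalizers and indices\<close>

text \<open>Stated as an equality of cosets, the notion does not mention inverses, so it has literally
the same meaning in every subgroup containing \<open>g\<close> and \<open>H\<close>.\<close>

definition normalizes :: "('a, 'b) monoid_scheme \<Rightarrow> 'a \<Rightarrow> 'a set \<Rightarrow> bool" where
  "normalizes G g H \<longleftrightarrow> g <#\<^bsub>G\<^esub> H = H #>\<^bsub>G\<^esub> g"

definition normalizer_in :: "('a, 'b) monoid_scheme \<Rightarrow> 'a set \<Rightarrow> 'a set \<Rightarrow> 'a set" where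
  "normalizer_in G A H = {g \<in> A. normalizes G g H}"

text \<open>The normalizer condition for the subgroup \<open>A\<close>: its proper subgroups are properly contained
in their normalizers. For finite groups this is one of the classical characterizations of
nilpotency; unlike the lower central series it can be tested inside the ambient group.\<close>

definition normalizer_condition :: "('a, 'b) monoid_scheme \<Rightarrow> 'a set \<Rightarrow> bool" where
  "normalizer_condition G A \<longleftrightarrow>
     (\<forall>H. subgroup H G \<and> H \<subset> A \<longrightarrow> (\<exists>g \<in> A - H. normalizes G g H))"

lemma normalizes_restrict [simp]: "normalizes (G\<lparr>carrier := A\<rparr>) g H = normalizes G g H"
  by (simp add: normalizes_def)

context group
begin

lemma normalizes_iff_conj:
  assumes "H \<subseteq> carrier G" "g \<in> carrier G"
  shows "normalizes G g H \<longleftrightarrow> g <# H #> inv g = H"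
proof
  assume "normalizes G g H"
  then show "g <# H #> inv g = H"
    using assms by (simp add: normalizes_def coset_mult_assoc)
next
  assume "g <# H #> inv g = H"
  then have "H #> g = (g <# H #> inv g) #> g" by simp
  also have "\<dots> = g <# H"
    using assms by (simp add: coset_mult_assoc l_coset_subset_G)
  finally show "normalizes G g H" by (simp add: normalizes_def)
qed

lemma normalizes_conjD:
  assumes "normalizes G g H" "H \<subseteq> carrier G" "g \<in> carrier G" "h \<in> H"
  shows "g \<otimes> h \<otimes> inv g \<in> H"
proof -
  have "g \<otimes> h \<otimes> inv g \<in> g <# H #> inv g"
    using assms(4) by (auto simp: l_coset_def r_coset_def)
  then show ?thesis using assms normalizes_iff_conj by blast
qed

lemma normalizesI:
  assumes "H \<subseteq> carrier G" "g \<in> carrier G"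
    and 1: "\<And>h. h \<in> H \<Longrightarrow> g \<otimes> h \<otimes> inv g \<in> H"
    and 2: "\<And>h. h \<in> H \<Longrightarrow> inv g \<otimes> h \<otimes> g \<in> H"
  shows "normalizes G g H"
  unfolding normalizes_def
proof (intro equalityI subsetI)
  fix x assume "x \<in> g <# H"
  then obtain h where h: "h \<in> H" "x = g \<otimes> h" by (auto simp: l_coset_def)
  have hG: "h \<in> carrier G" using h assms by blast
  then have "x = (g \<otimes> h \<otimes> inv g) \<otimes> g" using h assms(2) by (simp add: m_assoc)
  then show "x \<in> H #> g" using 1[OF h(1)] by (auto simp: r_coset_def)
next
  fix x assume "x \<in> H #> g"
  then obtain h where h: "h \<in> H" "x = h \<otimes> g" by (auto simp: r_coset_def)
  have hG: "h \<in> carrier G" using h assms by blast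
  then have "x = g \<otimes> (inv g \<otimes> h \<otimes> g)"
    using h assms(2) by (simp add: m_assoc r_inv flip: m_assoc[of g "inv g"])
  then show "x \<in> g <# H" using 2[OF h(1)] by (auto simp: l_coset_def)
qed

text \<open>Conjugation is injective, so for finite \<open>H\<close> one inclusion is enough.\<close>

lemma normalizesI_finite:
  assumes "H \<subseteq> carrier G" "g \<in> carrier G" "finite H"
    and 1: "\<And>h. h \<in> H \<Longrightarrow> g \<otimes> h \<otimes> inv g \<in> H"
  shows "normalizes G g H"
proof -
  have inj: "inj_on (\<lambda>h. g \<otimes> h \<otimes> inv g) H"
    using assms(1,2) by (auto simp: inj_on_def subset_iff)
  then have "(\<lambda>h. g \<otimes> h \<otimes> inv g) ` H = H"
    using 1 assms(3) by (intro card_subset_eq) (auto simp: card_image)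
  moreover have "(\<lambda>h. g \<otimes> h \<otimes> inv g) ` H = g <# H #> inv g"
    by (auto simp: l_coset_def r_coset_def)
  ultimately show ?thesis using assms normalizes_iff_conj by simp
qed

lemma normalizes_member:
  assumes "subgroup H G" "h \<in> H"
  shows "normalizes G h H"
proof -
  interpret H: subgroup H G by fact
  show ?thesis using assms(2) by (intro normalizesI) auto
qed

lemma normalizes_conj_invD:
  assumes "normalizes G g H" "H \<subseteq> carrier G" "g \<in> carrier G" "h \<in> H"
  shows "inv g \<otimes> h \<otimes> g \<in> H"
proof -
  have "h \<otimes> g \<in> g <# H"
    using assms(1,4) by (auto simp: normalizes_def r_coset_def)
  then obtain h' where h': "h' \<in> H" "h \<otimes> g = g \<otimes> h'" by (auto simp: l_coset_def)
  have "inv g \<otimes> h \<otimes> g = inv g \<otimes> (h \<otimes> g)"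
    using assms by (intro m_assoc) auto
  also have "\<dots> = h'" using h' assms by (simp add: inv_solve_left' subset_iff)
  finally show ?thesis using h' by simp
qed

lemma normalizes_inv:
  assumes "normalizes G g H" "H \<subseteq> carrier G" "g \<in> carrier G"
  shows "normalizes G (inv g) H"
  using assms by (intro normalizesI) (simp_all add: normalizes_conjD normalizes_conj_invD)

lemma normalizer_in_subgroup:
  assumes "subgroup A G" "H \<subseteq> carrier G"
  shows "subgroup (normalizer_in G A H) G"
proof -
  interpret A: subgroup A G by fact
  show ?thesis
  proof
    show "normalizer_in G A H \<subseteq> carrier G" by (auto simp: normalizer_in_def)
    show "\<one> \<in> normalizer_in G A H"
      using assms(2) by (auto simp: normalizer_in_def normalizes_def lcos_mult_one)
    show "inv x \<in> normalizer_in G A H" if "x \<in> normalizer_in G A H" for x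
      using that assms(2) by (auto simp: normalizer_in_def normalizes_inv)
    show "x \<otimes> y \<in> normalizer_in G A H"
      if "x \<in> normalizer_in G A H" "y \<in> normalizer_in G A H" for x y
    proof -
      have xy: "x \<in> A" "y \<in> A" "x <# H = H #> x" "y <# H = H #> y"
        using that by (auto simp: normalizer_in_def normalizes_def)
      have "(x \<otimes> y) <# H = x <# (y <# H)"
        using xy(1,2) assms(2) by (intro lcos_m_assoc[symmetric]) auto
      also have "\<dots> = x <# (H #> y)" using xy(4) by (rule arg_cong)
      also have "\<dots> = (x <# H) #> y"
        using xy assms(2) by (intro coset_assoc) auto
      also have "\<dots> = (H #> x) #> y" by (simp only: xy(3))
      also have "\<dots> = H #> (x \<otimes> y)" using xy assms(2) by (simp add: coset_mult_assoc)
      finally show ?thesis using xy by (auto simp: normalizer_in_def normalizes_def)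
    qed
  qed
qed

lemma normalizer_in_supset:
  assumes "subgroup H G" "H \<subseteq> A"
  shows "H \<subseteq> normalizer_in G A H"
  using assms by (auto simp: normalizer_in_def normalizes_member)

lemma normalizes_imp_normal:
  assumes "subgroup H G" "subgroup K G" "H \<subseteq> K" "\<And>g. g \<in> K \<Longrightarrow> normalizes G g H"
  shows "H \<lhd> G\<lparr>carrier := K\<rparr>"
proof -
  interpret K: group "G\<lparr>carrier := K\<rparr>" using assms(2) subgroup_imp_group by blast
  show ?thesis
    using assms subgroup_incl[OF assms(1,2,3)]
    by (intro K.normalI) (auto simp: normalizes_def)
qed

lemma normal_iff_normalizes:
  assumes "subgroup H G"
  shows "H \<lhd> G \<longleftrightarrow> (\<forall>g \<in> carrier G. normalizes G g H)"
  using assms by (auto simp: normalizes_def normal_def normal_axioms_def is_group)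

lemma index_mult_card:
  assumes "subgroup A G" "subgroup H G" "H \<subseteq> A"
  shows "subgroup_index G A H * card H = card A"
proof -
  interpret A: group "G\<lparr>carrier := A\<rparr>" using assms(1) subgroup_imp_group by blast
  show ?thesis
    using A.lagrange[OF subgroup_incl[OF assms(2,1,3)]] by (simp add: order_def subgroup_index_def)
qed

lemma card_subgroup_dvd:
  assumes "subgroup A G" "subgroup H G" "H \<subseteq> A"
  shows "card H dvd card A"
  using index_mult_card[OF assms] by (metis dvd_triv_right)

text \<open>In the quotient by \<open>H\<close> the order of the coset of \<open>x\<close> divides both \<open>m\<close> and the order of the
quotient, so the coset is trivial.\<close>

lemma coprime_power_mem_normal:
  assumes "H \<lhd> G" "finite (carrier G)" "x \<in> carrier G" "x [^] (m::nat) \<in> H"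
    and "coprime m (card (rcosets H))"
  shows "x \<in> H"
proof -
  interpret N: normal H G by fact
  interpret Q: group "G Mod H" by (rule N.factorgroup_is_group)
  have fin: "finite (carrier (G Mod H))" using assms(2) by (simp add: carrier_FactGroup)
  have X: "H #> x \<in> carrier (G Mod H)" using assms(3) by (auto simp: carrier_FactGroup)
  have "(H #> x) [^]\<^bsub>G Mod H\<^esub> m = H #> (x [^] m)"
    using assms(3) by (rule N.FactGroup_pow)
  also have "\<dots> = \<one>\<^bsub>G Mod H\<^esub>" using assms by (simp add: N.rcos_const)
  finally have "Q.ord (H #> x) dvd m" using X Q.pow_eq_id by blast
  moreover have "Q.ord (H #> x) dvd card (rcosets H)"
    using Q.ord_dvd_group_order[OF X] by (simp add: order_def FactGroup_def)
  ultimately have "Q.ord (H #> x) = 1" using assms(5) by (metis coprime_common_divisor_nat)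
  then have "H #> x = H" using X Q.ord_eq_1 by auto
  then show ?thesis using assms(3) coset_join1 N.subset N.subgroup_axioms by (metis rcos_self)
qed

text \<open>The relative form: \<open>H\<close> is only normal in the subgroup \<open>K\<close>. It is the single step that is
iterated along chains of normalizers.\<close>

lemma coprime_power_mem:
  assumes "subgroup H G" "subgroup K G" "H \<subseteq> K" "finite K" "x \<in> K" "x [^] (m::nat) \<in> H"
    and "\<And>g. g \<in> K \<Longrightarrow> normalizes G g H"
    and "card K = n * card H" "coprime m n"
  shows "x \<in> H"
proof -
  interpret K: group "G\<lparr>carrier := K\<rparr>" using assms(2) subgroup_imp_group by blast
  interpret H: subgroup H G by fact
  have "card H > 0" using assms(3,4) by (metis H.subgroup_axioms card_gt_0_iff empty_iff finite_subset subgroup.one_closed)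
  then have "subgroup_index G K H = n"
    using index_mult_card[OF assms(2,1,3)] assms(8) by simp
  moreover have "x [^]\<^bsub>G\<lparr>carrier := K\<rparr>\<^esub> m \<in> H"
    using assms(6) nat_pow_consistent[of x m K] by simp
  ultimately show ?thesis
    using K.coprime_power_mem_normal[OF normalizes_imp_normal[OF assms(1,2,3,7)], of x m] assms(4,5,9)
    by (simp add: subgroup_index_def)
qed

end

section \<open>Elements of prime power order and the lower central series\<close>

definition p_elements :: "('a, 'b) monoid_scheme \<Rightarrow> nat \<Rightarrow> 'a set" where
  "p_elements G p = {x \<in> carrier G. \<exists>j::nat. x [^]\<^bsub>G\<^esub> (p ^ j) = \<one>\<^bsub>G\<^esub>}"

definition center :: "('a, 'b) monoid_scheme \<Rightarrow> 'a set" where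
  "center G = {x \<in> carrier G. \<forall>g \<in> carrier G. x \<otimes>\<^bsub>G\<^esub> g = g \<otimes>\<^bsub>G\<^esub> x}"

context group
begin

lemma inv_cancel_left [simp]:
  assumes "g \<in> carrier G" "x \<in> carrier G"
  shows "inv g \<otimes> (g \<otimes> x) = x" "g \<otimes> (inv g \<otimes> x) = x"
  using assms by (simp_all flip: m_assoc)

lemma conj_nat_pow:
  assumes "x \<in> carrier G" "g \<in> carrier G"
  shows "(g \<otimes> x \<otimes> inv g) [^] (n::nat) = g \<otimes> x [^] n \<otimes> inv g"
proof (induction n)
  case 0
  then show ?case using assms by simp
next
  case (Suc n)
  have "(g \<otimes> x \<otimes> inv g) [^] Suc n = (g \<otimes> x [^] n \<otimes> inv g) \<otimes> (g \<otimes> x \<otimes> inv g)"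
    by (simp add: Suc)
  also have "\<dots> = g \<otimes> x [^] n \<otimes> (inv g \<otimes> g) \<otimes> x \<otimes> inv g"
    using assms by (simp add: m_assoc del: l_inv)
  also have "\<dots> = g \<otimes> x [^] Suc n \<otimes> inv g"
    using assms by (simp add: m_assoc)
  finally show ?case .
qed

lemma conj_p_elements:
  assumes "x \<in> p_elements G p" "g \<in> carrier G"
  shows "g \<otimes> x \<otimes> inv g \<in> p_elements G p"
proof -
  obtain j :: nat where "x [^] (p ^ j) = \<one>" "x \<in> carrier G"
    using assms(1) by (auto simp: p_elements_def)
  then have "(g \<otimes> x \<otimes> inv g) [^] (p ^ j) = \<one>"
    using assms(2) by (simp add: conj_nat_pow)
  then show ?thesis using assms by (auto simp: p_elements_def)
qed

lemma pow_card_subgroup_eq_one: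
  assumes "subgroup S G" "x \<in> S"
  shows "x [^] card S = \<one>"
proof -
  interpret S: group "G\<lparr>carrier := S\<rparr>" using assms(1) subgroup_imp_group by blast
  show ?thesis
    using S.pow_order_eq_1[of x] assms(2) nat_pow_consistent[of x "card S" S]
    by (simp add: order_def)
qed

text \<open>Sylow's existence theorem inside a subgroup \<open>A\<close>, with all subgroups regarded as subgroups of
the ambient group.\<close>

lemma sylow_subgroup:
  assumes "subgroup A G" "finite A" "Factorial_Ring.prime (q::nat)"
  obtains S a m where "subgroup S G" "S \<subseteq> A" "S \<subseteq> p_elements G q"
    "card S = q ^ a" "card A = q ^ a * m" "\<not> q dvd m"
proof -
  interpret A: group "G\<lparr>carrier := A\<rparr>" using assms(1) subgroup_imp_group by blast
  have "card A \<noteq> 0" using assms(2) subgroup.one_closed[OF assms(1)] by auto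
  moreover have "\<not> is_unit q" using assms(3) using not_prime_unit by blast
  ultimately obtain m where m: "card A = q ^ multiplicity q (card A) * m" "\<not> q dvd m"
    using multiplicity_decompose'[of "card A" q] by blast
  define a where "a = multiplicity q (card A)"
  have "\<exists>S. subgroup S (G\<lparr>carrier := A\<rparr>) \<and> card S = q ^ a"
    using sylow_thm[of q "G\<lparr>carrier := A\<rparr>" a m] assms m(1) A.is_group
    by (simp add: order_def a_def)
  then obtain S where S: "subgroup S (G\<lparr>carrier := A\<rparr>)" "card S = q ^ a" by blast
  have SG: "subgroup S G" using S(1) assms(1) incl_subgroup by blast
  have "S \<subseteq> p_elements G q"
  proof
    fix x assume x: "x \<in> S"
    show "x \<in> p_elements G q"
      using pow_card_subgroup_eq_one[OF SG x] S(2) subgroup.mem_carrier[OF SG x]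
      by (auto simp: p_elements_def)
  qed
  moreover have "S \<subseteq> A" using subgroup.subset[OF S(1)] by simp
  ultimately show thesis
    using that[OF SG _ _ S(2)] m unfolding a_def[symmetric] by blast
qed

text \<open>The subgroup \<open>H\<close> contains a Sylow \<open>q\<close>-subgroup of \<open>A\<close>, so the full power of \<open>q\<close> dividing the
order of \<open>A\<close> already divides the order of \<open>H\<close>.\<close>

lemma prime_not_dvd_index:
  assumes "subgroup A G" "subgroup H G" "H \<subseteq> A" "finite A"
    and q: "Factorial_Ring.prime (q::nat)"
    and "A \<inter> p_elements G q \<subseteq> H" "card A = i * card H"
  shows "\<not> q dvd i"
proof
  assume "q dvd i"
  obtain S a m where S: "subgroup S G" "S \<subseteq> A" "S \<subseteq> p_elements G q"
    "card S = q ^ a" "card A = q ^ a * m" "\<not> q dvd m"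
    using sylow_subgroup[OF assms(1,4) q] by metis
  have "q ^ a dvd card H"
    using card_subgroup_dvd[OF assms(2) S(1)] S assms(6) by auto
  then have "q * q ^ a dvd card A" unfolding assms(7) using \<open>q dvd i\<close> by (rule mult_dvd_mono[rotated])
  then have "q dvd m" using S(5) q by (auto simp: mult.commute prime_gt_0_nat)
  then show False using S(6) by blast
qed

text \<open>Let \<open>S\<close> be a Sylow \<open>p\<close>-subgroup of \<open>A\<close>. It is normal in its normalizer \<open>N\<close> and of index prime
to \<open>p\<close> there, so it consists of all elements of \<open>N\<close> of \<open>p\<close>-power order. Hence \<open>S\<close> is preserved by
every element that normalizes \<open>N\<close>, which makes \<open>N\<close> self-normalizing, and \<open>N = A\<close> by the
normalizer condition.\<close>

lemma p_elements_subgroup: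
  assumes "subgroup A G" "finite A" "normalizer_condition G A"
    and p: "Factorial_Ring.prime (p::nat)"
  obtains a m where "subgroup (A \<inter> p_elements G p) G" "card (A \<inter> p_elements G p) = p ^ a"
    "card A = p ^ a * m" "\<not> p dvd m"
proof -
  interpret A: subgroup A G by fact
  obtain S a m where S: "subgroup S G" "S \<subseteq> A" "S \<subseteq> p_elements G p"
    "card S = p ^ a" "card A = p ^ a * m" "\<not> p dvd m"
    using sylow_subgroup[OF assms(1,2) p] by metis
  have SG: "S \<subseteq> carrier G" using S(1) subgroup.subset by blast
  define N where "N = normalizer_in G A S"
  have N: "subgroup N G" "N \<subseteq> A" "S \<subseteq> N"
    using normalizer_in_subgroup[OF assms(1) SG] normalizer_in_supset[OF S(1,2)]
    by (auto simp: N_def normalizer_in_def)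
  \<comment> \<open>inside the normalizer, \<open>S\<close> already contains every element of \<open>p\<close>-power order\<close>
  have NS: "x \<in> S" if h: "x \<in> N" "x \<in> p_elements G p" for x
  proof -
    obtain j where j: "x [^] (p ^ j) = \<one>" using h(2) by (auto simp: p_elements_def)
    obtain n where n: "card N = card S * n"
      using card_subgroup_dvd[OF N(1) S(1) N(3)] by blast
    have "card S * n dvd card A"
      using card_subgroup_dvd[OF assms(1) N(1,2)] n by simp
    then have "n dvd m" using S(4,5) p by (simp add: prime_gt_0_nat)
    then have "\<not> p dvd n" using S(6) dvd_trans by blast
    then have "coprime (p ^ j) n" using p by (simp add: prime_imp_coprime)
    moreover have "finite N" using N(2) assms(2) finite_subset by blast
    moreover have "x [^] (p ^ j) \<in> S" using j subgroup.one_closed[OF S(1)] by simp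
    moreover have "\<And>g. g \<in> N \<Longrightarrow> normalizes G g S" by (simp add: N_def normalizer_in_def)
    moreover have "card N = n * card S" using n by simp
    ultimately show ?thesis by (intro coprime_power_mem[OF S(1) N(1,3) _ h(1)])
  qed
  have "N = A"
  proof (rule ccontr)
    assume "N \<noteq> A"
    then obtain g where g: "g \<in> A - N" "normalizes G g N"
      using assms(3) N(1,2) by (metis normalizer_condition_def psubsetI)
    have "normalizes G g S"
    proof (rule normalizesI_finite)
      fix s assume s: "s \<in> S"
      have "g \<otimes> s \<otimes> inv g \<in> N"
        using normalizes_conjD[OF g(2)] g(1) s N(3) subgroup.subset[OF N(1)] by auto
      then show "g \<otimes> s \<otimes> inv g \<in> S"
        using NS conj_p_elements s S(3) g(1) A.mem_carrier by blast
    qed (use SG g S(2) assms(2) finite_subset A.mem_carrier in auto)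
    then show False using g(1) by (simp add: N_def normalizer_in_def)
  qed
  then have "A \<inter> p_elements G p = S" using NS S(2,3) by blast
  then show thesis using that S by metis
qed

lemma lower_central_series_subgroup: "subgroup (lower_central_series G n) G"
proof (induction n)
  case 0
  then show ?case by (simp add: subgroup_self)
next
  case (Suc n)
  show ?case
    using subgroup.mem_carrier[OF Suc] by (auto intro!: generate_is_subgroup)
qed

text \<open>If \<open>L\<close> is the last term of the lower central series with \<open>L \<inter> A \<not>\<subseteq> H\<close>, then the commutators of
\<open>L \<inter> A\<close> with \<open>H\<close> lie in the next term intersected with \<open>A\<close>, hence in \<open>H\<close>, so \<open>L \<inter> A\<close>
normalizes \<open>H\<close>. The hypothesis covers subgroups \<open>A\<close> of nilpotent groups, where the series
reaches the trivial group, as well as \<open>A = G\<close> with a series that only descends into \<open>H\<close>.\<close>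

lemma normalizer_grows:
  assumes "subgroup A G" "subgroup H G" "lower_central_series G n \<inter> A \<subseteq> H" "H \<subset> A"
  obtains g where "g \<in> A - H" "normalizes G g H"
proof -
  interpret A: subgroup A G by fact
  interpret H: subgroup H G by fact
  have "\<not> lower_central_series G 0 \<inter> A \<subseteq> H" using assms(4) A.subset by auto
  then obtain i where i: "\<not> lower_central_series G i \<inter> A \<subseteq> H"
    "lower_central_series G (Suc i) \<inter> A \<subseteq> H"
    using assms(3) by (induction n) auto
  interpret L: subgroup "lower_central_series G i" G by (rule lower_central_series_subgroup)
  obtain g where g: "g \<in> lower_central_series G i" "g \<in> A" "g \<notin> H" using i(1) by blast
  have conj: "c \<otimes> h \<otimes> inv c \<in> H" if "c \<in> lower_central_series G i" "c \<in> A" "h \<in> H" for c h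
  proof -
    have cG: "c \<in> carrier G" "h \<in> carrier G" "h \<in> A" using that assms(4) by auto
    have "c \<otimes> h \<otimes> inv c \<otimes> inv h \<in> lower_central_series G (Suc i)"
      unfolding lower_central_series.simps
      by (rule generate.incl) (use that(1) cG(2) in blast)
    moreover have "c \<otimes> h \<otimes> inv c \<otimes> inv h \<in> A" using that cG by simp
    ultimately have "c \<otimes> h \<otimes> inv c \<otimes> inv h \<in> H" using i(2) by blast
    then have "(c \<otimes> h \<otimes> inv c \<otimes> inv h) \<otimes> h \<in> H" using that(3) by simp
    then show ?thesis using cG by (simp add: m_assoc)
  qed
  have "normalizes G g H"
  proof (rule normalizesI)
    fix h assume h: "h \<in> H"
    show "g \<otimes> h \<otimes> inv g \<in> H" using conj[OF g(1,2) h] .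
    show "inv g \<otimes> h \<otimes> g \<in> H"
      using conj[of "inv g" h] g h by simp
  qed (use g in auto)
  then show thesis using that g by blast
qed

lemma center_mult_closed:
  assumes "x \<in> center G" "y \<in> center G"
  shows "x \<otimes> y \<in> center G"
proof -
  have xy: "x \<in> carrier G" "y \<in> carrier G" using assms by (auto simp: center_def)
  have "x \<otimes> y \<otimes> g = g \<otimes> (x \<otimes> y)" if g: "g \<in> carrier G" for g
  proof -
    have "x \<otimes> y \<otimes> g = x \<otimes> (g \<otimes> y)"
      using assms(2) xy g by (simp add: m_assoc center_def)
    also have "\<dots> = (g \<otimes> x) \<otimes> y"
      using assms(1) xy g by (simp add: center_def flip: m_assoc)
    finally show ?thesis using xy g by (simp add: m_assoc)
  qed
  then show ?thesis using xy by (simp add: center_def)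
qed

lemma commutator_mem_iff:
  assumes "K \<lhd> G" "x \<in> carrier G" "g \<in> carrier G"
  shows "x \<otimes> g \<otimes> inv x \<otimes> inv g \<in> K \<longleftrightarrow>
    (K #> x) \<otimes>\<^bsub>G Mod K\<^esub> (K #> g) = (K #> g) \<otimes>\<^bsub>G Mod K\<^esub> (K #> x)"
proof -
  interpret K: normal K G by fact
  have "x \<otimes> g \<otimes> inv x \<otimes> inv g = (x \<otimes> g) \<otimes> inv (g \<otimes> x)"
    using assms by (simp add: inv_mult_group m_assoc)
  moreover have "K #> (x \<otimes> g) = K #> (g \<otimes> x) \<longleftrightarrow> (x \<otimes> g) \<otimes> inv (g \<otimes> x) \<in> K"
    using K.rcos_module[OF is_group, of "g \<otimes> x" "x \<otimes> g"] assms repr_independence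
      K.subgroup_axioms rcos_self by (metis m_closed)
  ultimately show ?thesis using assms by (simp add: K.rcos_sum)
qed

text \<open>The preimage of the center of the quotient is the next term of an ascending central series
starting with \<open>K\<close>.\<close>

lemma center_preimage_normal:
  assumes "K \<lhd> G"
  defines "Z \<equiv> {x \<in> carrier G. K #> x \<in> center (G Mod K)}"
  shows "Z \<lhd> G" "K \<subseteq> Z"
    and "x \<in> Z \<Longrightarrow> g \<in> carrier G \<Longrightarrow> x \<otimes> g \<otimes> inv x \<otimes> inv g \<in> K"
proof -
  interpret K: normal K G by fact
  have Z_iff: "x \<in> Z \<longleftrightarrow> x \<in> carrier G \<and> (\<forall>g \<in> carrier G. x \<otimes> g \<otimes> inv x \<otimes> inv g \<in> K)" for x
    using commutator_mem_iff[OF assms(1)] by (auto simp: Z_def center_def carrier_FactGroup)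
  show comm: "x \<in> Z \<Longrightarrow> g \<in> carrier G \<Longrightarrow> x \<otimes> g \<otimes> inv x \<otimes> inv g \<in> K" for x g
    by (simp add: Z_iff)
  show "K \<subseteq> Z"
  proof
    fix x assume x: "x \<in> K"
    have "x \<otimes> g \<otimes> inv x \<otimes> inv g \<in> K" if "g \<in> carrier G" for g
    proof -
      have "g \<otimes> inv x \<otimes> inv g \<in> K" using that x K.inv_op_closed2 by simp
      then show ?thesis using x that K.m_closed[of x "g \<otimes> inv x \<otimes> inv g"] by (simp add: m_assoc)
    qed
    then show "x \<in> Z" using x by (simp add: Z_iff)
  qed
  have conj: "g \<otimes> x \<otimes> inv g \<in> Z" if "x \<in> Z" "g \<in> carrier G" for x g
  proof -
    have x: "x \<in> carrier G" using that Z_iff by blast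
    have "inv (x \<otimes> g \<otimes> inv x \<otimes> inv g) \<in> K" using comm that by simp
    then have "g \<otimes> x \<otimes> inv g \<otimes> inv x \<in> K" using that x by (simp add: inv_mult_group m_assoc)
    then have "g \<otimes> x \<otimes> inv g \<in> K #> x"
      using K.rcos_module_rev[OF is_group, of x "g \<otimes> x \<otimes> inv g"] x that by simp
    then have "K #> (g \<otimes> x \<otimes> inv g) = K #> x"
      using repr_independence[OF _ x] K.subgroup_axioms by simp
    then show ?thesis using that x by (simp add: Z_def)
  qed
  interpret Q: group "G Mod K" by (rule K.factorgroup_is_group)
  have "subgroup Z G"
  proof
    show "Z \<subseteq> carrier G" unfolding Z_def by blast
    show "\<one> \<in> Z" by (rule subsetD[OF \<open>K \<subseteq> Z\<close> K.one_closed])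
  next
    fix x y assume xy: "x \<in> Z" "y \<in> Z"
    show "x \<otimes> y \<in> Z"
    proof -
      have prod: "K #> (x \<otimes> y) = (K #> x) \<otimes>\<^bsub>G Mod K\<^esub> (K #> y)"
        using xy by (simp add: Z_def K.rcos_sum)
      have c: "K #> x \<in> center (G Mod K)" "K #> y \<in> center (G Mod K)"
        using xy unfolding Z_def by blast+
      have "(K #> x) \<otimes>\<^bsub>G Mod K\<^esub> (K #> y) \<in> center (G Mod K)"
        using Q.center_mult_closed[OF c] .
      then show ?thesis using prod xy by (simp add: Z_def)
    qed
  next
    fix x assume x: "x \<in> Z"
    show "inv x \<in> Z"
    proof -
      have xG: "x \<in> carrier G" using x by (simp add: Z_def)
      have "inv x \<otimes> g \<otimes> inv (inv x) \<otimes> inv g \<in> K" if g: "g \<in> carrier G" for g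
      proof -
        have "inv x \<otimes> (g \<otimes> x \<otimes> inv g \<otimes> inv x) \<otimes> x \<in> K"
        proof -
          have "inv (x \<otimes> g \<otimes> inv x \<otimes> inv g) \<in> K" using comm x g by simp
          then have "g \<otimes> x \<otimes> inv g \<otimes> inv x \<in> K" using g xG by (simp add: inv_mult_group m_assoc)
          then show ?thesis using K.inv_op_closed1[of x] xG by simp
        qed
        then show ?thesis using xG g by (simp add: m_assoc)
      qed
      then show ?thesis using xG by (simp add: Z_iff)
    qed
  qed
  then show "Z \<lhd> G" using conj by (simp add: normal_inv_iff)
qed

text \<open>By the hypothesis an ascending central series starting from any normal \<open>K \<supseteq> N\<close> is strictly
increasing until it reaches \<open>G\<close>. The lower central series descends at least as fast along it,
one term per step.\<close>

lemma lower_central_series_le_normal: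
  assumes "N \<lhd> G" "finite (carrier G)"
    and center: "\<And>K. K \<lhd> G \<Longrightarrow> N \<subseteq> K \<Longrightarrow> K \<noteq> carrier G \<Longrightarrow> center (G Mod K) \<noteq> {\<one>\<^bsub>G Mod K\<^esub>}"
  shows "\<exists>n. lower_central_series G n \<subseteq> N"
proof -
  have "\<exists>n. lower_central_series G n \<subseteq> K" if "K \<lhd> G" "N \<subseteq> K" for K
    using that
  proof (induction "card (carrier G) - card K" arbitrary: K rule: less_induct)
    case less
    interpret K: normal K G by (rule less.prems)
    interpret Q: group "G Mod K" by (rule K.factorgroup_is_group)
    show ?case
    proof (cases "K = carrier G")
      case True
      then have "lower_central_series G 0 \<subseteq> K" by simp
      then show ?thesis by blast
    next
      case False
      define Z where "Z = {x \<in> carrier G. K #> x \<in> center (G Mod K)}"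
      note Z = center_preimage_normal[OF less.prems(1), folded Z_def]
      have "\<one>\<^bsub>G Mod K\<^esub> \<in> center (G Mod K)" by (simp add: center_def del: one_FactGroup mult_FactGroup)
      then obtain C where C: "C \<in> center (G Mod K)" "C \<noteq> K"
        using center[OF less.prems False] by auto
      then obtain x where x: "x \<in> carrier G" "C = K #> x"
        by (auto simp: center_def carrier_FactGroup)
      have "x \<notin> K" using C(2) x K.rcos_const[OF is_group] by blast
      then have "K \<subset> Z" using Z(2) C(1) x by (auto simp: Z_def)
      moreover have fin: "finite Z" "Z \<subseteq> carrier G" using assms(2) by (auto simp: Z_def)
      ultimately have "card (carrier G) - card Z < card (carrier G) - card K"
        using psubset_card_mono[of Z K] card_mono[OF assms(2), of Z] by linarith
      then obtain n where n: "lower_central_series G n \<subseteq> Z"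
        using less.hyps[of Z] Z(1) \<open>K \<subset> Z\<close> less.prems(2) by blast
      have "lower_central_series G (Suc n) \<subseteq> K"
        unfolding lower_central_series.simps
        using n Z(3) by (intro generate_subgroup_incl K.subgroup_axioms) auto
      then show ?thesis by blast
    qed
  qed
  then show ?thesis using assms(1) by blast
qed

end

section \<open>Central elements and nilpotency\<close>

lemma prime_power_if_unique_prime_divisor:
  assumes "(i::nat) > 0" "Factorial_Ring.prime p"
    "\<And>q. Factorial_Ring.prime q \<Longrightarrow> q \<noteq> p \<Longrightarrow> \<not> q dvd i"
  shows "\<exists>k. i = p ^ k"
proof -
  have "i \<noteq> 0" "\<not> is_unit p" using assms(1,2) not_prime_unit by blast+
  then obtain y where y: "i = p ^ multiplicity p i * y" "\<not> p dvd y"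
    using multiplicity_decompose' by blast
  have "y = 1"
  proof (rule ccontr)
    assume "y \<noteq> 1"
    then obtain q where q: "Factorial_Ring.prime q" "q dvd y" using prime_factor_nat by blast
    then have "q dvd i" using y(1) by (metis dvd_mult)
    moreover have "q \<noteq> p" using q(2) y(2) by blast
    ultimately show False using assms(3) q(1) by blast
  qed
  then show ?thesis using y(1) by auto
qed

lemma quotient_hom:
  assumes "K \<lhd> G"
  shows "group_hom G (G Mod K) (\<lambda>x. K #>\<^bsub>G\<^esub> x)"
proof -
  interpret K: normal K G by fact
  show ?thesis
    by (simp add: group_hom_def group_hom_axioms_def K.is_group K.factorgroup_is_group
        K.r_coset_hom_Mod)
qed

lemma (in group_hom) subgroup_preimage:
  assumes "subgroup B H"
  shows "subgroup {x \<in> carrier G. h x \<in> B} G"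
proof -
  interpret B: subgroup B H by fact
  show ?thesis by unfold_locales auto
qed

text \<open>The preimage of a proper subgroup is proper, and whatever normalizes it maps to an element
normalizing the subgroup.\<close>

lemma (in group_hom) normalizer_condition_image:
  assumes "h ` carrier G = carrier H" "normalizer_condition G (carrier G)"
  shows "normalizer_condition H (carrier H)"
  unfolding normalizer_condition_def
proof (intro allI impI)
  fix B assume B: "subgroup B H \<and> B \<subset> carrier H"
  then interpret B: subgroup B H by blast
  define A where "A = {x \<in> carrier G. h x \<in> B}"
  have A: "subgroup A G" unfolding A_def using B by (intro subgroup_preimage) blast
  obtain y where y: "y \<in> carrier H" "y \<notin> B" using B by blast
  then obtain x where "x \<in> carrier G" "y = h x" using assms(1) by blast
  then have "A \<subset> carrier G" using y by (auto simp: A_def)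
  then obtain g where g: "g \<in> carrier G - A" "normalizes G g A"
    using assms(2) A unfolding normalizer_condition_def by blast
  have "normalizes H (h g) B"
  proof (rule H.normalizesI)
    fix b assume b: "b \<in> B"
    then obtain a where a: "a \<in> A" "b = h a"
      using assms(1) B.subset by (auto simp: A_def image_iff set_eq_iff) (metis B.mem_carrier)
    have aG: "a \<in> carrier G" using a by (auto simp: A_def)
    have "g \<otimes>\<^bsub>G\<^esub> a \<otimes>\<^bsub>G\<^esub> inv\<^bsub>G\<^esub> g \<in> A" "inv\<^bsub>G\<^esub> g \<otimes>\<^bsub>G\<^esub> a \<otimes>\<^bsub>G\<^esub> g \<in> A"
      using G.normalizes_conjD[OF g(2) _ _ a(1)] G.normalizes_conj_invD[OF g(2) _ _ a(1)] g(1)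
        subgroup.subset[OF A] by auto
    then show "h g \<otimes>\<^bsub>H\<^esub> b \<otimes>\<^bsub>H\<^esub> inv\<^bsub>H\<^esub> h g \<in> B" "inv\<^bsub>H\<^esub> h g \<otimes>\<^bsub>H\<^esub> b \<otimes>\<^bsub>H\<^esub> h g \<in> B"
      using a(2) aG g(1) by (auto simp: A_def)
  qed (use g(1) B.subset in auto)
  moreover have "h g \<in> carrier H - B" using g(1) by (auto simp: A_def)
  ultimately show "\<exists>g \<in> carrier H - B. normalizes H g B" by blast
qed

context group
begin

lemma centralizer_subgroup:
  assumes "x \<in> carrier G"
  shows "subgroup {g \<in> carrier G. g \<otimes> x = x \<otimes> g} G"
proof
  fix g k assume gk: "g \<in> {g \<in> carrier G. g \<otimes> x = x \<otimes> g}" "k \<in> {g \<in> carrier G. g \<otimes> x = x \<otimes> g}"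
  have "g \<otimes> k \<otimes> x = g \<otimes> (x \<otimes> k)" using gk assms by (simp add: m_assoc)
  also have "\<dots> = x \<otimes> g \<otimes> k" using gk assms by (simp flip: m_assoc)
  finally show "g \<otimes> k \<in> {g \<in> carrier G. g \<otimes> x = x \<otimes> g}" using gk assms by (simp add: m_assoc)
next
  fix g assume g: "g \<in> {g \<in> carrier G. g \<otimes> x = x \<otimes> g}"
  then have gG: "g \<in> carrier G" and comm: "g \<otimes> x = x \<otimes> g" by blast+
  have "inv g \<otimes> x = inv g \<otimes> (x \<otimes> g) \<otimes> inv g" using gG assms by (simp add: m_assoc)
  also have "\<dots> = inv g \<otimes> (g \<otimes> x) \<otimes> inv g" by (simp only: comm)
  also have "\<dots> = x \<otimes> inv g" using gG assms by simp
  finally show "inv g \<in> {g \<in> carrier G. g \<otimes> x = x \<otimes> g}" using g assms by simp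
qed (use assms in auto)

text \<open>The orbit counting argument behind the class equation. The set \<open>W\<close> is a union of conjugacy
classes whose sizes are powers of \<open>p\<close>; since \<open>p\<close> divides the size of \<open>W\<close> and \<open>\<one>\<close> forms a class
of size one, there must be another class of size one. Allowing a set \<open>W\<close> smaller than the whole
group makes the lemma applicable to a normal Sylow subgroup of a group that is not a \<open>p\<close>-group.\<close>

lemma conj_closed_set_meets_center:
  assumes "finite (carrier G)" "Factorial_Ring.prime (p::nat)" "W \<subseteq> carrier G" "\<one> \<in> W" "p dvd card W"
    and conj: "\<And>g x. g \<in> carrier G \<Longrightarrow> x \<in> W \<Longrightarrow> g \<otimes> x \<otimes> inv g \<in> W"
    and index: "\<And>x. x \<in> W \<Longrightarrow> \<exists>k. order G = p ^ k * card {g \<in> carrier G. g \<otimes> x = x \<otimes> g}"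
  shows "\<exists>x \<in> W - {\<one>}. x \<in> center G"
proof (rule ccontr)
  assume no: "\<not> (\<exists>x \<in> W - {\<one>}. x \<in> center G)"
  define \<phi> where "\<phi> = (\<lambda>g. \<lambda>h \<in> carrier G. g \<otimes> h \<otimes> inv g)"
  interpret \<phi>: group_action G "carrier G" \<phi>
    unfolding \<phi>_def by (rule action_by_conjugation)
  have orbit: "orbit G \<phi> x = {g \<otimes> x \<otimes> inv g | g. g \<in> carrier G}" if "x \<in> carrier G" for x
    using that by (simp add: orbit_def \<phi>_def)
  have fixed: "g \<otimes> x \<otimes> inv g = x \<longleftrightarrow> g \<otimes> x = x \<otimes> g" if "x \<in> carrier G" "g \<in> carrier G" for x g
    using that by (metis inv_solve_right m_closed)
  have stab: "stabilizer G \<phi> x = {g \<in> carrier G. g \<otimes> x = x \<otimes> g}" if "x \<in> carrier G" for x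
    using that fixed by (auto simp: stabilizer_def \<phi>_def)
  have finW: "finite W" using assms(1,3) finite_subset by blast
  define S where "S = orbit G \<phi> ` (W - {\<one>})"
  have sub: "orbit G \<phi> x \<subseteq> W - {\<one>}" if "x \<in> W - {\<one>}" for x
  proof
    have xG: "x \<in> carrier G" using that assms(3) by blast
    fix y assume "y \<in> orbit G \<phi> x"
    then obtain g where g: "g \<in> carrier G" "y = g \<otimes> x \<otimes> inv g"
      unfolding orbit[OF xG] by blast
    have "y \<noteq> \<one>"
    proof
      assume "y = \<one>"
      then have "x = \<one>" using g xG fixed[of \<one> g] by (metis inv_equality inv_inv inv_closed l_cancel_one' m_closed)
      then show False using that by blast
    qed
    then show "y \<in> W - {\<one>}" using conj g that by blast
  qed
  have self: "x \<in> orbit G \<phi> x" if "x \<in> W" for x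
    using \<phi>.orbit_refl that assms(3) by blast
  have union: "\<Union>S = W - {\<one>}" unfolding S_def using sub self by blast
  have "p dvd card C" if C: "C \<in> S" for C
  proof -
    obtain x where x: "x \<in> W - {\<one>}" "C = orbit G \<phi> x" using C by (auto simp: S_def)
    have xG: "x \<in> carrier G" using x assms(3) by blast
    obtain k where "order G = p ^ k * card (stabilizer G \<phi> x)"
      using index[of x] x(1) stab[OF xG] by auto
    moreover have "card (orbit G \<phi> x) * card (stabilizer G \<phi> x) = order G"
      using \<phi>.orbit_stabilizer_theorem xG by blast
    moreover have "order G > 0" using assms(1) order_gt_0_iff_finite by blast
    ultimately have card: "card C = p ^ k" using x(2) by auto
    have "k \<noteq> 0"
    proof
      assume "k = 0"
      then have "C = {x}" using card self[of x] x by (auto simp: card_1_singleton_iff)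
      have "x \<otimes> g = g \<otimes> x" if g: "g \<in> carrier G" for g
      proof -
        have "g \<otimes> x \<otimes> inv g \<in> C" unfolding x(2) orbit[OF xG] using g by blast
        then have "g \<otimes> x \<otimes> inv g = x" using \<open>C = {x}\<close> by blast
        then show ?thesis using fixed[OF xG g] by simp
      qed
      then have "x \<in> center G" using xG by (simp add: center_def)
      then show False using no x(1) by blast
    qed
    then show ?thesis by (simp add: card)
  qed
  moreover have "card (W - {\<one>}) = sum card S"
    unfolding union[symmetric]
  proof (rule card_Union_disjoint)
    show "pairwise disjnt S"
      unfolding pairwise_def disjnt_def S_def
      using \<phi>.disjoint_union assms(3) by (auto simp: orbits_def)
    show "finite C" if "C \<in> S" for C
    proof (rule finite_subset)
      show "C \<subseteq> W" using that union by blast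
    qed (rule finW)
  qed
  ultimately have "p dvd card (W - {\<one>})" by (simp add: dvd_sum)
  moreover have "card W = Suc (card (W - {\<one>}))"
    using finW assms(4) by (metis card_Suc_Diff1)
  ultimately have "p dvd 1" using assms(5) by (metis Suc_eq_plus1 dvd_add_right_iff)
  then show False using assms(2) not_prime_unit by blast
qed

lemma p_group_center:
  assumes "Factorial_Ring.prime (p::nat)" "order G = p ^ k" "carrier G \<noteq> {\<one>}"
  shows "center G \<noteq> {\<one>}"
proof -
  have fin: "finite (carrier G)"
    using assms(1,2) by (metis order_gt_0_iff_finite prime_gt_0_nat zero_less_power)
  have "k \<noteq> 0" using assms(2,3) fin order_one_triv_iff by fastforce
  then have "p dvd card (carrier G)" using assms(2) by (simp add: order_def)
  moreover have "\<exists>j. order G = p ^ j * card {g \<in> carrier G. g \<otimes> x = x \<otimes> g}" if "x \<in> carrier G" for x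
  proof -
    let ?C = "{g \<in> carrier G. g \<otimes> x = x \<otimes> g}"
    have *: "card (rcosets ?C) * card ?C = order G" by (rule lagrange[OF centralizer_subgroup[OF that]])
    then have "card (rcosets ?C) dvd p ^ k"
      unfolding assms(2)[symmetric] by (rule dvdI[OF sym])
    then obtain i where "card (rcosets ?C) = p ^ i"
      using divides_primepow_nat[OF assms(1)] by blast
    then have "order G = p ^ i * card ?C" using * by simp
    then show ?thesis by blast
  qed
  ultimately have "\<exists>x \<in> carrier G - {\<one>}. x \<in> center G"
    using fin assms(1) by (intro conj_closed_set_meets_center) auto
  then show ?thesis by blast
qed

text \<open>Take \<open>W\<close> to be a nontrivial Sylow \<open>p\<close>-subgroup; it is normal and consists of all elements of
\<open>p\<close>-power order. An element \<open>x\<close> of it commutes with every element \<open>y\<close> of \<open>q\<close>-power order for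
\<open>q \<noteq> p\<close>, because their commutator lies in two normal subgroups with trivial intersection. So the
centralizer of \<open>x\<close> contains all these \<open>y\<close>, and its index is a power of \<open>p\<close>.\<close>

lemma normalizer_condition_center:
  assumes "finite (carrier G)" "normalizer_condition G (carrier G)" "carrier G \<noteq> {\<one>}"
  shows "center G \<noteq> {\<one>}"
proof -
  have sub: "p_elements G q \<subseteq> carrier G" for q by (auto simp: p_elements_def)
  then have inter: "carrier G \<inter> p_elements G q = p_elements G q" for q by blast
  note sylow = p_elements_subgroup[OF subgroup_self assms(1,2), unfolded inter]
  have "order G \<noteq> 1" using assms(3) order_one_triv_iff by blast
  then obtain p where p: "Factorial_Ring.prime p" "p dvd order G" using prime_factor_nat by blast
  obtain a m where a: "subgroup (p_elements G p) G" "card (p_elements G p) = p ^ a"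
    "card (carrier G) = p ^ a * m" "\<not> p dvd m" using sylow[OF p(1)] by metis
  have "a \<noteq> 0" using a(3,4) p(2) by (auto simp: order_def intro: ccontr)
  then have dvd: "p dvd card (p_elements G p)" using a(2) by simp
  have "\<exists>k. order G = p ^ k * card {g \<in> carrier G. g \<otimes> x = x \<otimes> g}" if x: "x \<in> p_elements G p" for x
  proof -
    have xG: "x \<in> carrier G" using x sub by blast
    let ?C = "{g \<in> carrier G. g \<otimes> x = x \<otimes> g}"
    note C = centralizer_subgroup[OF xG]
    let ?i = "card (rcosets ?C)"
    have i: "?i * card ?C = order G" by (rule lagrange[OF C])
    have "?i > 0" using i assms(1) order_gt_0_iff_finite by (metis gr_zeroI mult_is_0)
    moreover have "\<not> q dvd ?i" if q: "Factorial_Ring.prime q" "q \<noteq> p" for q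
    proof (rule prime_not_dvd_index[OF subgroup_self C _ assms(1) q(1)])
      show "carrier G \<inter> p_elements G q \<subseteq> ?C"
      proof
        fix y assume y: "y \<in> carrier G \<inter> p_elements G q"
        interpret P: subgroup "p_elements G p" G by (rule a(1))
        interpret Q: subgroup "p_elements G q" G using sylow[OF q(1)] by metis
        have yG: "y \<in> carrier G" using y by blast
        let ?c = "x \<otimes> y \<otimes> inv x \<otimes> inv y"
        have "x \<otimes> (y \<otimes> inv x \<otimes> inv y) \<in> p_elements G p"
          using x yG conj_p_elements by simp
        then have cp: "?c \<in> p_elements G p" using xG yG by (simp add: m_assoc)
        have cq: "?c \<in> p_elements G q" using y xG conj_p_elements by simp
        obtain j where "?c [^] (p ^ j) = \<one>" using cp unfolding p_elements_def by blast
        moreover obtain l where "?c [^] (q ^ l) = \<one>" using cq unfolding p_elements_def by blast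
        moreover have cG: "?c \<in> carrier G" using xG yG by simp
        ultimately have "ord ?c dvd p ^ j" "ord ?c dvd q ^ l" using pow_eq_id by auto
        moreover have "coprime (p ^ j) (q ^ l)"
          using p(1) q by (simp add: primes_coprime)
        ultimately have "ord ?c = 1" by (metis coprime_common_divisor_nat)
        then have "?c = \<one>" using cG ord_eq_1 by blast
        then have "x \<otimes> y \<otimes> inv x = y" using xG yG by (metis inv_equality inv_inv m_closed inv_closed)
        then have "x \<otimes> y = y \<otimes> x" using xG yG by (metis inv_solve_right' m_closed)
        then show "y \<in> ?C" using yG by simp
      qed
      show "card (carrier G) = ?i * card ?C" using i by (simp add: order_def)
    qed auto
    ultimately obtain k where "?i = p ^ k"
      using prime_power_if_unique_prime_divisor[of ?i p] p(1) by blast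
    then have "order G = p ^ k * card ?C" using i by simp
    then show ?thesis by blast
  qed
  then have "\<exists>x \<in> p_elements G p - {\<one>}. x \<in> center G"
    using dvd conj_p_elements sub a(1) assms(1) p(1)
    by (intro conj_closed_set_meets_center) (auto simp: subgroup.one_closed)
  then show ?thesis by blast
qed

lemma finite_quotient_carrier:
  assumes "finite (carrier G)"
  shows "finite (carrier (G Mod K))"
  using assms by (simp add: carrier_FactGroup)

lemma quotient_nontrivial:
  assumes "K \<lhd> G" "K \<noteq> carrier G"
  shows "carrier (G Mod K) \<noteq> {\<one>\<^bsub>G Mod K\<^esub>}"
proof
  interpret K: normal K G by fact
  assume "carrier (G Mod K) = {\<one>\<^bsub>G Mod K\<^esub>}"
  then have "x \<in> K" if "x \<in> carrier G" for x
    using that rcos_self[OF that K.subgroup_axioms] by (auto simp: carrier_FactGroup)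
  then show False using assms(2) K.subset by blast
qed

lemma normalizer_condition_imp_nilpotent:
  assumes "finite (carrier G)" "normalizer_condition G (carrier G)"
  shows "nilpotent G"
proof -
  have "\<exists>n. lower_central_series G n \<subseteq> {\<one>}"
  proof (rule lower_central_series_le_normal[OF one_is_normal assms(1)])
    fix K assume K: "K \<lhd> G" "K \<noteq> carrier G"
    interpret q: group_hom G "G Mod K" "\<lambda>x. K #> x" by (rule quotient_hom[OF K(1)])
    have "normalizer_condition (G Mod K) (carrier (G Mod K))"
      by (rule q.normalizer_condition_image[OF _ assms(2)]) (simp add: carrier_FactGroup)
    then show "center (G Mod K) \<noteq> {\<one>\<^bsub>G Mod K\<^esub>}"
      using q.H.normalizer_condition_center[OF finite_quotient_carrier[OF assms(1)]]
        quotient_nontrivial[OF K] by blast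
  qed
  then obtain n where n: "lower_central_series G n \<subseteq> {\<one>}" by blast
  have "\<one> \<in> lower_central_series G n"
    using lower_central_series_subgroup subgroup.one_closed by blast
  then have "lower_central_series G n = {\<one>}" using n by blast
  then show ?thesis by (auto simp: nilpotent_def)
qed

text \<open>All quotients by proper normal subgroups above \<open>N\<close> are nontrivial \<open>p\<close>-groups.\<close>

lemma lower_central_series_le_p_index:
  assumes "finite (carrier G)" "Factorial_Ring.prime (p::nat)" "N \<lhd> G" "order G = p ^ k * card N"
  shows "\<exists>n. lower_central_series G n \<subseteq> N"
proof (rule lower_central_series_le_normal[OF assms(3,1)])
  fix K assume K: "K \<lhd> G" "N \<subseteq> K" "K \<noteq> carrier G"
  interpret q: group_hom G "G Mod K" "\<lambda>x. K #> x" by (rule quotient_hom[OF K(1)])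
  have sub: "subgroup N G" "subgroup K G" using assms(3) K(1) normal_imp_subgroup by blast+
  obtain j where j: "card K = card N * j" using card_subgroup_dvd[OF sub(2,1) K(2)] by blast
  have "card N > 0" using assms(1) sub(1) subgroup.one_closed[OF sub(1)] subgroup.subset[OF sub(1)]
    by (metis card_gt_0_iff empty_iff finite_subset)
  moreover have "card (rcosets K) * card K = order G" by (rule lagrange[OF sub(2)])
  ultimately have "card (rcosets K) * j = p ^ k" using j assms(4) by (simp add: mult.left_commute mult.commute)
  then have "card (rcosets K) dvd p ^ k" by (metis dvd_triv_left)
  then obtain i where "card (rcosets K) = p ^ i" using assms(2) divides_primepow_nat by blast
  then have "order (G Mod K) = p ^ i" by (simp add: order_def FactGroup_def)
  then show "center (G Mod K) \<noteq> {\<one>\<^bsub>G Mod K\<^esub>}"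
    using q.H.p_group_center[OF assms(2)] quotient_nontrivial[OF K(1,3)] by blast
qed

end

text \<open>The form of transitivity of \<open>p\<close>-commensurability on which the induction over finite groups runs.
Indices are expressed by orders so that the property is visibly inherited by subgroups.\<close>

definition p_index_closed :: "('a, 'b) monoid_scheme \<Rightarrow> bool" where
  "p_index_closed G \<longleftrightarrow> (\<forall>(p::nat) A B C. Factorial_Ring.prime p \<longrightarrow>
     subgroup A G \<longrightarrow> subgroup B G \<longrightarrow> subgroup C G \<longrightarrow> A \<subseteq> C \<longrightarrow> B \<subseteq> C \<longrightarrow>
     (\<exists>a. card C = p ^ a * card A) \<longrightarrow> (\<exists>b. card C = p ^ b * card B) \<longrightarrow>
     (\<exists>k. card C = p ^ k * card (A \<inter> B)))"

context group
begin

text \<open>Among the subgroups of \<open>M\<close> of \<open>p\<close>-power index in \<open>G\<close>, one of least order is normal: its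
intersection with any of its conjugates belongs to the same family.\<close>

lemma p_index_closed_normal_core:
  assumes "finite (carrier G)" "Factorial_Ring.prime (p::nat)" "p_index_closed G"
    "subgroup M G" "order G = p ^ a * card M"
  obtains N k where "N \<lhd> G" "N \<subseteq> M" "order G = p ^ k * card N"
proof -
  define P where "P = (\<lambda>N. subgroup N G \<and> N \<subseteq> M \<and> (\<exists>k. order G = p ^ k * card N))"
  have "P M" using assms(4,5) by (auto simp: P_def)
  then obtain N where N: "P N" "\<And>N'. P N' \<Longrightarrow> card N \<le> card N'"
    using ex_has_least_nat[of P M card] by blast
  then obtain k where k: "subgroup N G" "N \<subseteq> M" "order G = p ^ k * card N" by (auto simp: P_def)
  interpret N: subgroup N G by (rule k(1))
  have finN: "finite N" using assms(1) N.subset finite_subset by blast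
  have "g \<otimes> x \<otimes> inv g \<in> N" if g: "g \<in> carrier G" and x: "x \<in> N" for g x
  proof -
    \<comment> \<open>conjugating by the inverse makes \<open>N \<inter> B = N\<close> say that \<open>g\<close> conjugates \<open>N\<close> into itself\<close>
    define B where "B = inv g <# N #> g"
    have B: "subgroup B G"
      unfolding B_def using subgroup_conjugation_is_surj1[OF g k(1)] .
    have img: "B = (\<lambda>h. inv g \<otimes> h \<otimes> g) ` N" by (auto simp: B_def l_coset_def r_coset_def)
    have inj: "inj_on (\<lambda>h. inv g \<otimes> h \<otimes> g) N" using g by (auto simp: inj_on_def)
    then have "card B = card N" by (simp add: img card_image)
    then have "\<exists>j. card (carrier G) = p ^ j * card (N \<inter> B)"
      using assms(3)[unfolded p_index_closed_def, rule_format, OF assms(2) k(1) B subgroup_self]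
        k(3) N.subset subgroup.subset[OF B] by (auto simp: order_def)
    then have "P (N \<inter> B)"
      using subgroups_Inter_pair[OF k(1) B] k(2) by (auto simp: P_def order_def)
    then have "N \<inter> B = N" using N(2) finN by (metis card_seteq inf_le1)
    then obtain h where h: "h \<in> N" "x = inv g \<otimes> h \<otimes> g" using x img by blast
    then have "g \<otimes> x \<otimes> inv g = h" using g by (simp add: m_assoc)
    then show ?thesis using h(1) by simp
  qed
  then have "N \<lhd> G" using k(1) by (simp add: normal_inv_iff)
  then show thesis using that k(2,3) by blast
qed

end

section \<open>Maximal subgroups and their conjugates\<close>

definition maximal_subgroup :: "('a, 'b) monoid_scheme \<Rightarrow> 'a set \<Rightarrow> bool" where
  "maximal_subgroup G M \<longleftrightarrow> subgroup M G \<and> M \<noteq> carrier G \<and>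
     (\<forall>K. subgroup K G \<and> M \<subseteq> K \<longrightarrow> K = M \<or> K = carrier G)"

definition conjugates :: "('a, 'b) monoid_scheme \<Rightarrow> 'a set \<Rightarrow> 'a set set" where
  "conjugates G A = {g <#\<^bsub>G\<^esub> A #>\<^bsub>G\<^esub> inv\<^bsub>G\<^esub> g | g. g \<in> carrier G}"

context group
begin

lemma exists_maximal_subgroup:
  assumes "finite (carrier G)" "subgroup H G" "H \<noteq> carrier G"
  obtains M where "maximal_subgroup G M" "H \<subseteq> M"
proof -
  let ?P = "\<lambda>M. subgroup M G \<and> H \<subseteq> M \<and> M \<noteq> carrier G"
  have "\<forall>M. ?P M \<longrightarrow> card M < Suc (card (carrier G))"
    by (simp add: less_Suc_eq_le card_mono[OF assms(1)] subgroup.subset)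
  then obtain M where M: "?P M" "\<And>K. ?P K \<Longrightarrow> card K \<le> card M"
    using ex_has_greatest_nat[of ?P H card "Suc (card (carrier G))"] assms(2,3) by blast
  have "K = M \<or> K = carrier G" if "subgroup K G" "M \<subseteq> K" for K
  proof (rule ccontr)
    assume "\<not> (K = M \<or> K = carrier G)"
    moreover from this have "card K \<le> card M" using M that by blast
    moreover have "finite K" using assms(1) subgroup.subset[OF that(1)] finite_subset by blast
    ultimately show False using card_seteq[of K M] that by blast
  qed
  then have "maximal_subgroup G M" using M(1) by (simp add: maximal_subgroup_def)
  then show thesis using that M(1) by simp
qed

lemma conj_maximal_subgroup:
  assumes "maximal_subgroup G M" "g \<in> carrier G"
  shows "maximal_subgroup G (g <# M #> inv g)"
proof -
  have M: "subgroup M G" "M \<noteq> carrier G"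
    and max: "\<And>K. subgroup K G \<Longrightarrow> M \<subseteq> K \<Longrightarrow> K = M \<or> K = carrier G"
    using assms(1) by (auto simp: maximal_subgroup_def)
  let ?M = "g <# M #> inv g"
  have sub: "M \<subseteq> carrier G" by (rule subgroup.subset[OF M(1)])
  have conj_inv: "inv g <# ?M #> g = M"
    using subgroup_conjugation_is_surj0[of "inv g" M] assms(2) sub by simp
  have carrier: "g <# carrier G #> inv g = carrier G"
    using normalizes_iff_conj[of "carrier G" g] normalizes_member[OF subgroup_self assms(2)] assms(2)
    by simp
  have "K = ?M \<or> K = carrier G" if K: "subgroup K G" "?M \<subseteq> K" for K
  proof -
    have K': "subgroup (inv g <# K #> g) G" using subgroup_conjugation_is_surj1[OF assms(2) K(1)] .
    have "inv g <# ?M #> g \<subseteq> inv g <# K #> g" using K(2) by (auto simp: l_coset_def r_coset_def)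
    then have "M \<subseteq> inv g <# K #> g" unfolding conj_inv .
    then have "inv g <# K #> g = M \<or> inv g <# K #> g = carrier G" using max K' by blast
    moreover have "K = g <# (inv g <# K #> g) #> inv g"
      using subgroup_conjugation_is_surj0[OF assms(2) subgroup.subset[OF K(1)]] by simp
    ultimately show ?thesis using carrier by metis
  qed
  moreover have "subgroup ?M G" using subgroup_conjugation_is_surj2[OF assms(2) M(1)] .
  moreover have "?M \<noteq> carrier G"
  proof
    assume "?M = carrier G"
    then have "inv g <# carrier G #> g = M" using conj_inv by simp
    then show False
      using M(2) normalizes_iff_conj[of "carrier G" "inv g"]
        normalizes_member[OF subgroup_self, of "inv g"] assms(2) by simp
  qed
  ultimately show ?thesis unfolding maximal_subgroup_def by blast
qed

lemma maximal_subgroup_self_normalizing: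
  assumes "maximal_subgroup G M" "\<not> M \<lhd> G" "g \<in> carrier G" "normalizes G g M"
  shows "g \<in> M"
proof (rule ccontr)
  assume "g \<notin> M"
  have M: "subgroup M G" using assms(1) by (simp add: maximal_subgroup_def)
  let ?N = "normalizer_in G (carrier G) M"
  have "subgroup ?N G" "M \<subseteq> ?N"
    using normalizer_in_subgroup[OF subgroup_self subgroup.subset[OF M]]
      normalizer_in_supset[OF M subgroup.subset[OF M]] by simp_all
  moreover have "g \<in> ?N" using assms(3,4) by (simp add: normalizer_in_def)
  ultimately have "?N = carrier G"
    using assms(1) \<open>g \<notin> M\<close> unfolding maximal_subgroup_def by blast
  then have "M \<lhd> G" using normal_iff_normalizes[OF M] by (auto simp: normalizer_in_def)
  then show False using assms(2) by blast
qed

lemma conjugates_self: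
  assumes "A \<subseteq> carrier G"
  shows "A \<in> conjugates G A"
proof -
  have "A = \<one> <# A #> inv \<one>" using assms by (simp add: lcos_mult_one)
  then show ?thesis unfolding conjugates_def by blast
qed

lemma conjugates_maximal:
  assumes "maximal_subgroup G M" "B \<in> conjugates G M"
  shows "maximal_subgroup G B"
  using assms conj_maximal_subgroup by (auto simp: conjugates_def)

lemma conjugates_contain_normal:
  assumes "D \<lhd> G" "D \<subseteq> A" "A \<subseteq> carrier G" "B \<in> conjugates G A"
  shows "D \<subseteq> B"
proof -
  obtain g where g: "g \<in> carrier G" "B = g <# A #> inv g" using assms(4) by (auto simp: conjugates_def)
  have "D \<subseteq> carrier G" using assms(2,3) by blast
  then have "g <# D #> inv g = D"
    using normal_iff_normalizes[OF normal_imp_subgroup[OF assms(1)]] assms(1) g(1)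
      normalizes_iff_conj[of D g] by simp
  moreover have "g <# D #> inv g \<subseteq> g <# A #> inv g" using assms(2) by (auto simp: l_coset_def r_coset_def)
  ultimately show ?thesis using g(2) by simp
qed

lemma card_conj:
  assumes "A \<subseteq> carrier G" "g \<in> carrier G"
  shows "card (g <# A #> inv g) = card A"
proof -
  have "g <# A #> inv g = (\<lambda>h. g \<otimes> h \<otimes> inv g) ` A" by (auto simp: l_coset_def r_coset_def)
  moreover have "inj_on (\<lambda>h. g \<otimes> h \<otimes> inv g) A" using assms by (auto simp: inj_on_def subset_iff)
  ultimately show ?thesis by (simp add: card_image)
qed

lemma conjugates_eq_orbit:
  assumes "subgroup A G"
  shows "conjugates G A = orbit G (\<lambda>g. \<lambda>H \<in> {H. subgroup H G}. g <# H #> inv g) A"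
  using assms by (simp add: conjugates_def orbit_def)

lemma conjugates_disjoint:
  assumes "subgroup A G" "subgroup B G" "B \<notin> conjugates G A"
  shows "conjugates G A \<inter> conjugates G B = {}"
proof -
  interpret act: group_action G "{H. subgroup H G}" "\<lambda>g. \<lambda>H \<in> {H. subgroup H G}. g <# H #> inv g"
    by (rule action_by_conjugation_on_subgroups_set)
  have "conjugates G A = conjugates G B \<or> conjugates G A \<inter> conjugates G B = {}"
    unfolding conjugates_eq_orbit[OF assms(1)] conjugates_eq_orbit[OF assms(2)]
    using assms by (intro act.disjoint_union) (auto simp: orbits_def)
  then show ?thesis using conjugates_self[OF subgroup.subset[OF assms(2)]] assms(3) by blast
qed

lemma card_conjugates_maximal:
  assumes "maximal_subgroup G M" "\<not> M \<lhd> G"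
  shows "card (conjugates G M) * card M = order G"
proof -
  let ?\<phi> = "\<lambda>g. \<lambda>H \<in> {H. subgroup H G}. g <# H #> inv g"
  \<comment> \<open>the stabilizer of \<open>M\<close> under conjugation is its normalizer, which is \<open>M\<close>\<close>
  interpret act: group_action G "{H. subgroup H G}" ?\<phi>
    by (rule action_by_conjugation_on_subgroups_set)
  have M: "subgroup M G" using assms(1) by (simp add: maximal_subgroup_def)
  have sub: "M \<subseteq> carrier G" by (rule subgroup.subset[OF M])
  have "stabilizer G ?\<phi> M = M"
  proof (intro equalityI subsetI)
    fix g assume "g \<in> stabilizer G ?\<phi> M"
    then have "g \<in> carrier G" "g <# M #> inv g = M" using M by (auto simp: stabilizer_def)
    then show "g \<in> M"
      using maximal_subgroup_self_normalizing[OF assms] normalizes_iff_conj[OF sub] by blast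
  next
    fix g assume g: "g \<in> M"
    then have "g \<in> carrier G" using sub by blast
    then have "g <# M #> inv g = M"
      using normalizes_member[OF M g] normalizes_iff_conj[OF sub] by blast
    then show "g \<in> stabilizer G ?\<phi> M" using M \<open>g \<in> carrier G\<close> by (simp add: stabilizer_def)
  qed
  then show ?thesis
    using act.orbit_stabilizer_theorem[of M] M conjugates_eq_orbit[OF M] by simp
qed

text \<open>The conjugates of \<open>M\<close> number \<open>|G| / |M|\<close>, as \<open>M\<close> is self-normalizing, and pairwise meet in \<open>D\<close>.
Hence \<open>|U| = |G| - |D| |G| / |M|\<close>. Since \<open>2 \<le> |M| / |D|\<close> this is at least half of the order of
\<open>G\<close>, and since \<open>2 \<le> |G| / |M|\<close> it is less than the number of elements outside \<open>D\<close>.\<close>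

lemma conjugates_union_card:
  assumes fin: "finite (carrier G)" and M: "maximal_subgroup G M" "\<not> M \<lhd> G"
    and D: "D \<lhd> G" "D \<subset> M"
    and inter: "\<And>A B. maximal_subgroup G A \<Longrightarrow> maximal_subgroup G B \<Longrightarrow> A \<noteq> B \<Longrightarrow>
      D \<subseteq> A \<Longrightarrow> D \<subseteq> B \<Longrightarrow> A \<inter> B = D"
  defines "U \<equiv> \<Union>(conjugates G M) - D"
  shows "order G \<le> 2 * card U" "card U + card D < order G"
proof -
  have Msub: "subgroup M G" "M \<subseteq> carrier G" "M \<noteq> carrier G"
    using M(1) by (simp_all add: maximal_subgroup_def subgroup.subset)
  have Dsub: "subgroup D G" using D(1) normal_imp_subgroup by blast
  have finM: "finite M" using fin Msub(2) finite_subset by blast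
  have finD: "finite D" using finM D(2) finite_subset by blast
  define c where "c = card (conjugates G M)"
  have sub: "B \<subseteq> carrier G" if "B \<in> conjugates G M" for B
    using conjugates_maximal[OF M(1) that] by (simp add: maximal_subgroup_def subgroup.subset)
  have finC: "finite (conjugates G M)" unfolding conjugates_def using fin by simp
  have c: "c * card M = order G" unfolding c_def by (rule card_conjugates_maximal[OF M])
  have "U = (\<Union>B \<in> conjugates G M. B - D)" by (auto simp: U_def)
  moreover have "card (\<Union>B \<in> conjugates G M. B - D) = (\<Sum>B \<in> conjugates G M. card (B - D))"
  proof (rule card_UN_disjoint[OF finC])
    show "\<forall>B \<in> conjugates G M. finite (B - D)" using sub fin finite_subset by blast
    show "\<forall>A \<in> conjugates G M. \<forall>B \<in> conjugates G M. A \<noteq> B \<longrightarrow> (A - D) \<inter> (B - D) = {}"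
      using inter conjugates_maximal[OF M(1)] conjugates_contain_normal[OF D(1) _ Msub(2)] D(2) by blast
  qed
  moreover have "card (B - D) = card M - card D" if B: "B \<in> conjugates G M" for B
  proof -
    have "D \<subseteq> B" using conjugates_contain_normal[OF D(1) _ Msub(2) B] D(2) by blast
    moreover have "card B = card M" using B card_conj[OF Msub(2)] by (auto simp: conjugates_def)
    ultimately show ?thesis by (simp add: card_Diff_subset finD)
  qed
  ultimately have U: "card U = c * (card M - card D)" by (simp add: c_def)
  obtain e where e: "card M = card D * e" using card_subgroup_dvd[OF Msub(1) Dsub] D(2) by blast
  have lt: "card D < card M" using D(2) finM psubset_card_mono by blast
  have "card D > 0" using finD subgroup.one_closed[OF Dsub] card_gt_0_iff by blast
  have "e \<ge> 2"
  proof (rule ccontr)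
    assume "\<not> e \<ge> 2"
    then have "e = 0 \<or> e = 1" by linarith
    then show False using e lt by auto
  qed
  then have "2 * card D \<le> card M" unfolding e by (simp add: mult.commute)
  then have "card M \<le> 2 * (card M - card D)" by linarith
  then have "c * card M \<le> c * (2 * (card M - card D))" by (rule mult_le_mono2)
  then show "order G \<le> 2 * card U" using U c by (simp add: mult.left_commute)
  have "card M < order G" using psubset_card_mono[OF fin, of M] Msub(2,3) by (auto simp: order_def)
  have "c \<ge> 2"
  proof (rule ccontr)
    assume "\<not> c \<ge> 2"
    then have "c = 0 \<or> c = 1" by linarith
    then show False using c \<open>card M < order G\<close> by auto
  qed
  then have "2 * card D \<le> c * card D" by (rule mult_le_mono1)
  moreover have "card U + c * card D = order G"
  proof -
    have "card U + c * card D = c * (card M - card D + card D)" using U by (simp add: add_mult_distrib2)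
    then show ?thesis using lt c by simp
  qed
  ultimately show "card U + card D < order G" using \<open>card D > 0\<close> by linarith
qed

text \<open>The counting argument that excludes simple groups all of whose proper subgroups are nilpotent,
carried out relative to a normal subgroup. Suppose that no maximal subgroup is normal, and let
\<open>D\<close> be an intersection of two different maximal subgroups of largest possible order. The
normalizer of \<open>D\<close> meets both of them in more than \<open>D\<close>, so it lies in no maximal subgroup, and
\<open>D\<close> is normal. Any two maximal subgroups above \<open>D\<close> then meet exactly in \<open>D\<close>. The conjugates of
one of them, \<open>A\<close>, do not cover \<open>G\<close>. An element \<open>x\<close> outside of them does not generate \<open>G\<close> together
with \<open>D\<close>, since otherwise it would centralize \<open>G\<close> modulo \<open>D\<close> and normalize \<open>A\<close>. So \<open>x\<close> lies in a
maximal subgroup above \<open>D\<close> from a second conjugacy class; but two classes together would have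
too many elements.\<close>

lemma exists_normal_maximal_subgroup:
  assumes fin: "finite (carrier G)"
    and nc: "\<And>H. subgroup H G \<Longrightarrow> H \<noteq> carrier G \<Longrightarrow> normalizer_condition G H"
    and M: "maximal_subgroup G M"
  shows "\<exists>N. maximal_subgroup G N \<and> N \<lhd> G"
proof (rule ccontr)
  assume none: "\<not> (\<exists>N. maximal_subgroup G N \<and> N \<lhd> G)"
  have maxD: "subgroup A G" "A \<subseteq> carrier G" "A \<noteq> carrier G" "finite A" "\<not> A \<lhd> G"
    if "maximal_subgroup G A" for A
  proof -
    show "subgroup A G" "A \<noteq> carrier G" using that by (simp_all add: maximal_subgroup_def)
    then show "A \<subseteq> carrier G" by (simp add: subgroup.subset)
    then show "finite A" using fin finite_subset by blast
    show "\<not> A \<lhd> G" using that none by blast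
  qed
  have max_eq: "A = B" if "maximal_subgroup G A" "maximal_subgroup G B" "A \<subseteq> B" for A B
    using that maxD(3)[of B] unfolding maximal_subgroup_def by blast
  obtain g where g: "g \<in> carrier G" "\<not> normalizes G g M"
    using normal_iff_normalizes maxD(1,5)[OF M] by blast
  have "g <# M #> inv g \<noteq> M" using g normalizes_iff_conj maxD(2)[OF M] by blast
  let ?P = "\<lambda>(A, B). maximal_subgroup G A \<and> maximal_subgroup G B \<and> A \<noteq> B"
  let ?f = "\<lambda>(A, B). card (A \<inter> B)"
  have 1: "?P (M, g <# M #> inv g)"
    using M conj_maximal_subgroup[OF M g(1)] \<open>g <# M #> inv g \<noteq> M\<close> by auto
  have 2: "\<forall>AB. ?P AB \<longrightarrow> ?f AB < Suc (card (carrier G))"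
    using maxD(2) fin by (auto simp: less_Suc_eq_le intro!: card_mono)
  obtain AB where AB: "?P AB" "\<forall>CD. ?P CD \<longrightarrow> ?f CD \<le> ?f AB"
    using ex_has_greatest_nat[OF 1 2] by (elim exE conjE) (rule that)
  obtain A B where [simp]: "AB = (A, B)" by (cases AB)
  have A: "maximal_subgroup G A" "maximal_subgroup G B" "A \<noteq> B" using AB(1) by auto
  define D where "D = A \<inter> B"
  have largest: "card (X1 \<inter> X2) \<le> card D"
    if "maximal_subgroup G X1" "maximal_subgroup G X2" "X1 \<noteq> X2" for X1 X2
    using AB(2)[rule_format, of "(X1, X2)"] that by (simp add: D_def)
  have "\<not> A \<subseteq> B" "\<not> B \<subseteq> A" using A max_eq[of A B] max_eq[of B A] by metis+
  then have D: "subgroup D G" "D \<subset> A" "D \<subset> B" "D \<subseteq> carrier G"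
    using subgroups_Inter_pair[OF maxD(1)[OF A(1)] maxD(1)[OF A(2)]] maxD(2)[OF A(1)]
    unfolding D_def by auto
  have "D \<lhd> G"
  proof (rule ccontr)
    assume "\<not> D \<lhd> G"
    define N where "N = normalizer_in G (carrier G) D"
    have "N \<noteq> carrier G"
      using \<open>\<not> D \<lhd> G\<close> normal_iff_normalizes[OF D(1)] by (auto simp: N_def normalizer_in_def)
    moreover have "subgroup N G"
      unfolding N_def by (rule normalizer_in_subgroup[OF subgroup_self D(4)])
    ultimately obtain L where L: "maximal_subgroup G L" "N \<subseteq> L"
      using exists_maximal_subgroup[OF fin] by blast
    have "L = C" if C: "maximal_subgroup G C" "D \<subset> C" for C
    proof (rule ccontr)
      assume "L \<noteq> C"
      obtain k where k: "k \<in> C - D" "normalizes G k D"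
        using nc[OF maxD(1,3)[OF C(1)]] D(1) C(2) unfolding normalizer_condition_def by blast
      then have "k \<in> L" using L(2) maxD(2)[OF C(1)] by (auto simp: N_def normalizer_in_def)
      moreover have "D \<subseteq> L"
        using normalizer_in_supset[OF D(1,4)] L(2) by (auto simp: N_def)
      ultimately have "D \<subset> L \<inter> C" using k(1) C(2) by blast
      then have "card D < card (L \<inter> C)" using maxD(4)[OF L(1)] by (intro psubset_card_mono) auto
      then show False using largest[OF L(1) C(1) \<open>L \<noteq> C\<close>] by linarith
    qed
    from this[OF A(1) D(2)] this[OF A(2) D(3)] show False using A(3) by simp
  qed
  have inter: "X1 \<inter> X2 = D" if "maximal_subgroup G X1" "maximal_subgroup G X2" "X1 \<noteq> X2" "D \<subseteq> X1" "D \<subseteq> X2" for X1 X2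
    using card_seteq[of "X1 \<inter> X2" D] largest[OF that(1-3)] that(4,5) maxD(4)[OF that(1)] by auto
  define U where "U C = \<Union>(conjugates G C) - D" for C
  note card_U = conjugates_union_card[OF fin _ maxD(5) \<open>D \<lhd> G\<close> _ inter, folded U_def]
  have sub: "U C \<subseteq> carrier G - D" if "maximal_subgroup G C" for C
  proof
    fix x assume "x \<in> U C"
    then obtain B where B: "B \<in> conjugates G C" "x \<in> B" "x \<notin> D" unfolding U_def by blast
    then show "x \<in> carrier G - D" using maxD(2)[OF conjugates_maximal[OF that B(1)]] by blast
  qed
  have card_compl: "card (carrier G - D) + card D = order G"
    using fin D(4) card_mono[OF fin D(4)] by (simp add: card_Diff_subset finite_subset order_def)
  have "U A \<noteq> carrier G - D"
    using card_U(2)[OF A(1) A(1) D(2)] card_compl by auto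
  then obtain x where x: "x \<in> carrier G" "x \<notin> D" "x \<notin> U A" using sub[OF A(1)] by blast
  have "x \<notin> A" using x(2,3) conjugates_self[OF maxD(2)[OF A(1)]] by (auto simp: U_def)
  define K where "K = generate G (insert x D)"
  have K: "subgroup K G" "insert x D \<subseteq> K"
    unfolding K_def using x(1) D(4) by (auto intro!: generate_is_subgroup generate.incl)
  show False
  proof (cases "K = carrier G")
    case True
    interpret q: group_hom G "G Mod D" "\<lambda>x. D #> x" by (rule quotient_hom[OF \<open>D \<lhd> G\<close>])
    \<comment> \<open>\<open>Z\<close> is the centralizer of \<open>x\<close> modulo \<open>D\<close>; it contains the generators \<open>x\<close> and \<open>D\<close> of \<open>G\<close>, so \<open>x\<close> normalizes \<open>A\<close>\<close>
    define Z where "Z = {y \<in> carrier G. D #> y \<in>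
      {Y \<in> carrier (G Mod D). Y \<otimes>\<^bsub>G Mod D\<^esub> (D #> x) = (D #> x) \<otimes>\<^bsub>G Mod D\<^esub> Y}}"
    have "subgroup Z G"
      unfolding Z_def by (intro q.subgroup_preimage q.H.centralizer_subgroup q.hom_closed x(1))
    have Z_iff: "y \<in> Z \<longleftrightarrow> y \<in> carrier G \<and> x \<otimes> y \<otimes> inv x \<otimes> inv y \<in> D" for y
      unfolding Z_def using commutator_mem_iff[OF \<open>D \<lhd> G\<close> x(1)] q.hom_closed by auto
    have "insert x D \<subseteq> Z"
    proof -
      have "x \<in> Z" using Z_iff x(1) subgroup.one_closed[OF D(1)] by (simp add: m_assoc)
      moreover have "y \<in> Z" if "y \<in> D" for y
      proof -
        have "x \<otimes> y \<otimes> inv x \<in> D" using normal.inv_op_closed2[OF \<open>D \<lhd> G\<close> x(1) that] .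
        then show ?thesis using Z_iff that D(4) subgroup.m_closed[OF D(1)] subgroup.m_inv_closed[OF D(1)] by auto
      qed
      ultimately show ?thesis by blast
    qed
    then have "K \<subseteq> Z" unfolding K_def using \<open>subgroup Z G\<close> by (rule generate_subgroup_incl)
    have "normalizes G x A"
    proof (rule normalizesI_finite[OF maxD(2)[OF A(1)] x(1) maxD(4)[OF A(1)]])
      fix m assume m: "m \<in> A"
      have mG: "m \<in> carrier G" using m maxD(2)[OF A(1)] by blast
      then have "x \<otimes> m \<otimes> inv x \<otimes> inv m \<in> A" using Z_iff \<open>K \<subseteq> Z\<close> True D(2) by blast
      then have "x \<otimes> m \<otimes> inv x \<otimes> inv m \<otimes> m \<in> A" using m subgroup.m_closed[OF maxD(1)[OF A(1)]] by blast
      then show "x \<otimes> m \<otimes> inv x \<in> A" using mG x(1) by (simp add: m_assoc)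
    qed
    then show False
      using maximal_subgroup_self_normalizing[OF A(1) maxD(5)[OF A(1)] x(1)] \<open>x \<notin> A\<close> by blast
  next
    case False
    then obtain C where C: "maximal_subgroup G C" "K \<subseteq> C"
      using exists_maximal_subgroup[OF fin K(1)] by blast
    have "D \<subset> C" "x \<in> C" using K(2) C(2) x(2) by blast+
    have notin: "C \<notin> conjugates G A" using \<open>x \<in> C\<close> x(2,3) by (auto simp: U_def)
    have "U A \<inter> U C = {}"
    proof -
      have "X1 \<inter> X2 = D" if "X1 \<in> conjugates G A" "X2 \<in> conjugates G C" for X1 X2
      proof (rule inter)
        show "X1 \<noteq> X2" using conjugates_disjoint[OF maxD(1)[OF A(1)] maxD(1)[OF C(1)] notin] that by blast
        show "D \<subseteq> X1" using conjugates_contain_normal[OF \<open>D \<lhd> G\<close> _ maxD(2)[OF A(1)] that(1)] D(2) by blast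
        show "D \<subseteq> X2" using conjugates_contain_normal[OF \<open>D \<lhd> G\<close> _ maxD(2)[OF C(1)] that(2)] \<open>D \<subset> C\<close> by blast
      qed (use that A(1) C(1) conjugates_maximal in blast)+
      then show ?thesis unfolding U_def by blast
    qed
    then have "card (U A) + card (U C) = card (U A \<union> U C)"
      using fin sub A(1) C(1) by (intro card_Un_disjoint[symmetric]) (auto intro: finite_subset)
    also have "\<dots> \<le> card (carrier G - D)" using sub A(1) C(1) fin by (intro card_mono) auto
    finally have "card (U A) + card (U C) + card D \<le> order G" using card_compl by linarith
    moreover have "order G \<le> 2 * card (U A)" using card_U(1)[OF A(1) A(1) D(2)] .
    moreover have "order G \<le> 2 * card (U C)" using card_U(1)[OF C(1) C(1) \<open>D \<subset> C\<close>] .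
    moreover have "card D > 0"
      using subgroup.one_closed[OF D(1)] fin D(4) finite_subset card_gt_0_iff by blast
    ultimately show False by linarith
  qed
qed

end

section \<open>Nilpotency from intersections of subgroups of prime power index\<close>

lemma p_index_closed_restrict:
  assumes "group G" "p_index_closed G" "subgroup C G"
  shows "p_index_closed (G\<lparr>carrier := C\<rparr>)"
proof -
  interpret group G by fact
  show ?thesis
    using assms(2) incl_subgroup[OF assms(3)] unfolding p_index_closed_def by metis
qed

lemma normalizer_condition_restrict:
  assumes "group G" "subgroup C G" "normalizer_condition (G\<lparr>carrier := C\<rparr>) C"
  shows "normalizer_condition G C"
  unfolding normalizer_condition_def
proof (intro allI impI)
  interpret group G by fact
  fix H assume "subgroup H G \<and> H \<subset> C"
  then have "subgroup H (G\<lparr>carrier := C\<rparr>) \<and> H \<subset> C"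
    using subgroup_incl[OF _ assms(2), of H] by blast
  then show "\<exists>g \<in> C - H. normalizes G g H"
    using assms(3) unfolding normalizer_condition_def normalizes_restrict by blast
qed

context group
begin

text \<open>The product formula for orders, read off from the second isomorphism theorem.\<close>

lemma card_normal_supplement:
  assumes "P \<lhd> G" "subgroup M G" "P <#> M = carrier G"
  shows "order G * card (P \<inter> M) = card P * card M"
proof -
  interpret second_isomorphism_grp P G M
    using assms(1,2) by (simp add: second_isomorphism_grp_def second_isomorphism_grp_axioms_def)
  have P: "subgroup P G" using assms(1) normal_imp_subgroup by blast
  have I: "subgroup (P \<inter> M) G" using subgroups_Inter_pair[OF P assms(2)] .
  have "card (carrier (G\<lparr>carrier := M\<rparr> Mod (P \<inter> M))) = card (carrier (G\<lparr>carrier := P <#> M\<rparr> Mod P))"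
    using normal_intersection_quotient_isom bij_betw_same_card unfolding iso_def by blast
  then have eq: "subgroup_index G M (P \<inter> M) = subgroup_index G (carrier G) P"
    by (simp add: subgroup_index_def FactGroup_def assms(3))
  have "subgroup_index G M (P \<inter> M) * card (P \<inter> M) = card M"
    by (rule index_mult_card[OF assms(2) I]) blast
  moreover have "subgroup_index G (carrier G) P * card P = order G"
    using index_mult_card[OF subgroup_self P subgroup.subset[OF P]] by (simp add: order_def)
  ultimately show ?thesis using eq by (metis mult.assoc mult.commute)
qed

text \<open>Suppose not. A normal maximal subgroup \<open>N\<close> differs from \<open>M\<close>, so some Sylow subgroup \<open>P\<close> of \<open>N\<close> is
not contained in \<open>M\<close>. It is normal in \<open>G\<close>, whence \<open>P M = G\<close> and \<open>M\<close> has \<open>p\<close>-power index. Then \<open>M\<close>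
contains a normal subgroup of \<open>p\<close>-power index, above which normalizers grow.\<close>

lemma maximal_subgroup_normal:
  assumes fin: "finite (carrier G)" and closed: "p_index_closed G"
    and nc: "\<And>H. subgroup H G \<Longrightarrow> H \<noteq> carrier G \<Longrightarrow> normalizer_condition G H"
    and M: "maximal_subgroup G M"
  shows "M \<lhd> G"
proof (rule ccontr)
  assume "\<not> M \<lhd> G"
  obtain N where N: "maximal_subgroup G N" "N \<lhd> G"
    using exists_normal_maximal_subgroup[OF fin nc M] by blast
  have M': "subgroup M G" "M \<noteq> carrier G" using M by (auto simp: maximal_subgroup_def)
  have N': "subgroup N G" "N \<noteq> carrier G" using N by (auto simp: maximal_subgroup_def)
  have sub: "M \<subseteq> carrier G" "N \<subseteq> carrier G" using M'(1) N'(1) by (simp_all add: subgroup.subset)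
  have "\<not> N \<subseteq> M"
  proof
    assume "N \<subseteq> M"
    then have "M = N" using N(1) M' unfolding maximal_subgroup_def by blast
    then show False using N(2) \<open>\<not> M \<lhd> G\<close> by simp
  qed
  have finN: "finite N" using sub fin finite_subset by blast
  \<comment> \<open>otherwise no prime divides the index of \<open>N \<inter> M\<close> in \<open>N\<close>\<close>
  have "\<exists>p. Factorial_Ring.prime p \<and> \<not> N \<inter> p_elements G p \<subseteq> M"
  proof (rule ccontr)
    assume none: "\<not> (\<exists>p. Factorial_Ring.prime p \<and> \<not> N \<inter> p_elements G p \<subseteq> M)"
    have I: "subgroup (N \<inter> M) G" using subgroups_Inter_pair[OF N'(1) M'(1)] .
    obtain i where i: "card N = i * card (N \<inter> M)"
      using card_subgroup_dvd[OF N'(1) I] by (auto simp: dvd_def mult.commute)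
    have "\<not> q dvd i" if "Factorial_Ring.prime q" for q
      using prime_not_dvd_index[OF N'(1) I _ finN that _ i] none that by blast
    then have "i = 1" using prime_factor_nat by blast
    then have "card (N \<inter> M) = card N" using i by simp
    then have "N \<inter> M = N" using card_subset_eq[OF finN, of "N \<inter> M"] by blast
    then show False using \<open>\<not> N \<subseteq> M\<close> by blast
  qed
  then obtain p where p: "Factorial_Ring.prime p" "\<not> N \<inter> p_elements G p \<subseteq> M" by blast
  define P where "P = N \<inter> p_elements G p"
  obtain a where P: "subgroup P G" "card P = p ^ a"
    using p_elements_subgroup[OF N'(1) finN nc[OF N'] p(1)] unfolding P_def by metis
  have "P \<lhd> G"
    unfolding normal_inv_iff P_def
  proof (intro conjI ballI)
    show "subgroup (N \<inter> p_elements G p) G" using P(1) by (simp add: P_def)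
    fix g x assume "g \<in> carrier G" "x \<in> N \<inter> p_elements G p"
    then show "g \<otimes> x \<otimes> inv g \<in> N \<inter> p_elements G p"
      using conj_p_elements normal.inv_op_closed2[OF N(2)] by simp
  qed
  interpret PM: second_isomorphism_grp P G M
    using \<open>P \<lhd> G\<close> M'(1) by (simp add: second_isomorphism_grp_def second_isomorphism_grp_axioms_def)
  have "P <#> M = carrier G"
  proof -
    have "subgroup (P <#> M) G" by (rule PM.normal_set_mult_subgroup)
    moreover have "M \<subseteq> P <#> M" by (rule PM.S_contained_in_set_mult)
    moreover have "P \<subseteq> P <#> M" by (rule PM.H_contained_in_set_mult)
    ultimately show ?thesis using M p(2) unfolding maximal_subgroup_def P_def[symmetric] by blast
  qed
  then have index: "order G * card (P \<inter> M) = card P * card M"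
    using card_normal_supplement[OF \<open>P \<lhd> G\<close> M'(1)] by blast
  have I: "subgroup (P \<inter> M) G" using subgroups_Inter_pair[OF P(1) M'(1)] .
  obtain r where r: "card P = card (P \<inter> M) * r" using card_subgroup_dvd[OF P(1) I] by blast
  obtain b where b: "r = p ^ b"
    using r P(2) divides_primepow_nat[OF p(1)] by (metis dvd_triv_right)
  have "card (P \<inter> M) > 0" using r P(2) p(1) by (metis gr0I mult_0 power_not_zero not_prime_0)
  then have "order G = p ^ b * card M" using index r b by (simp add: mult_ac)
  then obtain K k where K: "K \<lhd> G" "K \<subseteq> M" "order G = p ^ k * card K"
    using p_index_closed_normal_core[OF fin p(1) closed M'(1)] by metis
  then obtain n where "lower_central_series G n \<subseteq> K"
    using lower_central_series_le_p_index[OF fin p(1)] by blast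
  then obtain g where "g \<in> carrier G - M" "normalizes G g M"
    using normalizer_grows[OF subgroup_self M'(1), of n] K(2) sub(1) M'(2) by blast
  then show False using maximal_subgroup_self_normalizing[OF M \<open>\<not> M \<lhd> G\<close>] by blast
qed

end

text \<open>Induction on the order. For a proper subgroup \<open>H\<close> and a maximal subgroup \<open>M\<close> above it, either
\<open>H = M\<close> is normal, or the normalizer of \<open>H\<close> already grows inside \<open>M\<close>.\<close>

theorem p_index_closed_imp_normalizer_condition:
  fixes G :: "('a, 'b) monoid_scheme"
  assumes "group G" "finite (carrier G)" "p_index_closed G"
  shows "normalizer_condition G (carrier G)"
  using assms
proof (induction "order G" arbitrary: G rule: less_induct)
  case less
  interpret group G by (rule less.prems)
  have nc: "normalizer_condition G H" if H: "subgroup H G" "H \<noteq> carrier G" for H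
  proof (rule normalizer_condition_restrict[OF is_group H(1)])
    have sub: "H \<subset> carrier G" using H subgroup.subset by blast
    then have "finite H" "card H < order G"
      using less.prems(2) psubset_card_mono finite_subset by (auto simp: order_def)
    then show "normalizer_condition (G\<lparr>carrier := H\<rparr>) H"
      using less.hyps[of "G\<lparr>carrier := H\<rparr>"] subgroup_imp_group[OF H(1)]
        p_index_closed_restrict[OF is_group less.prems(3) H(1)] by (simp add: order_def)
  qed
  show ?case
    unfolding normalizer_condition_def
  proof (intro allI impI)
    fix H assume H: "subgroup H G \<and> H \<subset> carrier G"
    then obtain M where M: "maximal_subgroup G M" "H \<subseteq> M"
      using exists_maximal_subgroup[OF less.prems(2), of H] by blast
    have M': "subgroup M G" "M \<noteq> carrier G" using M by (auto simp: maximal_subgroup_def)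
    have sub: "M \<subseteq> carrier G" using M'(1) by (rule subgroup.subset)
    show "\<exists>g \<in> carrier G - H. normalizes G g H"
    proof (cases "H = M")
      case True
      have "M \<lhd> G" by (rule maximal_subgroup_normal[OF less.prems(2,3) nc M(1)])
      then have "\<forall>g \<in> carrier G. normalizes G g H"
        using True normal_iff_normalizes[OF M'(1)] by simp
      then show ?thesis using H by blast
    next
      case False
      then have "\<exists>g \<in> M - H. normalizes G g H"
        using nc[OF M'] H M(2) unfolding normalizer_condition_def by blast
      then show ?thesis using sub by blast
    qed
  qed
qed

section \<open>Commensurability in finite nilpotent groups\<close>

context group
begin

text \<open>Induction along the chain of iterated normalizers from \<open>H\<close> up to \<open>A\<close>: all steps are normal and
of \<open>p\<close>-power index, so an element of order prime to \<open>p\<close> descends through each of them.\<close>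

lemma nilpotent_p'_elements_mem:
  assumes "nilpotent G" "subgroup A G" "finite A" "Factorial_Ring.prime (p::nat)"
    and x: "x \<in> A" "x [^] (m::nat) = \<one>" "coprime m p"
    and "subgroup H G" "H \<subseteq> A" "card A = p ^ k * card H"
  shows "x \<in> H"
  using assms(8-)
proof (induction "card A - card H" arbitrary: H k rule: less_induct)
  case less
  show ?case
  proof (cases "H = A")
    case False
    obtain n where "lower_central_series G n = {\<one>}" using assms(1) by (auto simp: nilpotent_def)
    then have "lower_central_series G n \<inter> A \<subseteq> H" using subgroup.one_closed[OF less.prems(1)] by auto
    then obtain g where g: "g \<in> A - H" "normalizes G g H"
      using normalizer_grows[OF assms(2) less.prems(1)] less.prems(2) False by blast
    define K where "K = normalizer_in G A H"
    have K: "subgroup K G" "H \<subseteq> K" "K \<subseteq> A"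
      using normalizer_in_subgroup[OF assms(2) subgroup.subset[OF less.prems(1)]]
        normalizer_in_supset[OF less.prems(1,2)]
      by (auto simp: K_def normalizer_in_def)
    have "g \<in> K" using g by (simp add: K_def normalizer_in_def)
    have fin: "finite K" using K(3) assms(3) finite_subset by blast
    have "card H < card K" using \<open>g \<in> K\<close> g(1) K(2) fin by (intro psubset_card_mono) auto
    moreover have "card K \<le> card A" using K(3) assms(3) card_mono by blast
    ultimately have lt: "card A - card K < card A - card H" by linarith
    obtain r where r: "card A = card K * r" using card_subgroup_dvd[OF assms(2) K(1,3)] by blast
    obtain s where s: "card K = card H * s" using card_subgroup_dvd[OF K(1) less.prems(1) K(2)] by blast
    have "card H > 0" using fin K(2) subgroup.one_closed[OF less.prems(1)]
      by (metis card_gt_0_iff empty_iff finite_subset)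
    then have rs: "s * r = p ^ k" using r s less.prems(3) by (simp add: mult_ac)
    have "r dvd p ^ k" "s dvd p ^ k" unfolding rs[symmetric] by simp_all
    then obtain i j where ij: "r = p ^ i" "s = p ^ j"
      using divides_primepow_nat[OF assms(4)] by blast
    have "x \<in> K" using less.hyps[OF lt K(1,3), of i] r ij(1) by (simp add: mult.commute)
    have "x [^] m \<in> H" using x(2) subgroup.one_closed[OF less.prems(1)] by simp
    moreover have "\<And>g. g \<in> K \<Longrightarrow> normalizes G g H" by (simp add: K_def normalizer_in_def)
    moreover have "card K = s * card H" using s by simp
    moreover have "coprime m s" using x(3) ij(2) by simp
    ultimately show ?thesis
      by (rule coprime_power_mem[OF less.prems(1) K(1,2) fin \<open>x \<in> K\<close>])
  qed (use x in simp)
qed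

end

definition p_commensurable :: "nat \<Rightarrow> ('a, 'b) monoid_scheme \<Rightarrow> 'a set \<Rightarrow> 'a set \<Rightarrow> bool" where
  "p_commensurable p G A B \<longleftrightarrow>
     (\<exists>k. subgroup_index G A (A \<inter> B) * subgroup_index G B (A \<inter> B) = p ^ k)"

lemma p_commensurable_sym: "p_commensurable p G A B \<Longrightarrow> p_commensurable p G B A"
  by (simp add: p_commensurable_def Int_commute mult.commute)

context group
begin

lemma p_commensurable_iff_card:
  assumes "finite (carrier G)" "Factorial_Ring.prime p" "subgroup A G" "subgroup B G"
  shows "p_commensurable p G A B \<longleftrightarrow>
    (\<exists>i. card A = p ^ i * card (A \<inter> B)) \<and> (\<exists>j. card B = p ^ j * card (A \<inter> B))"
proof -
  have I: "subgroup (A \<inter> B) G" using subgroups_Inter_pair[OF assms(3,4)] .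
  have a: "subgroup_index G A (A \<inter> B) * card (A \<inter> B) = card A"
    by (rule index_mult_card[OF assms(3) I]) blast
  have b: "subgroup_index G B (A \<inter> B) * card (A \<inter> B) = card B"
    by (rule index_mult_card[OF assms(4) I]) blast
  have "finite (A \<inter> B)" using assms(1) subgroup.subset[OF I] finite_subset by blast
  then have pos: "card (A \<inter> B) > 0" using subgroup.one_closed[OF I] by (auto simp: card_gt_0_iff)
  show ?thesis
  proof
    assume "p_commensurable p G A B"
    then obtain k where k: "subgroup_index G A (A \<inter> B) * subgroup_index G B (A \<inter> B) = p ^ k"
      by (auto simp: p_commensurable_def)
    have "subgroup_index G A (A \<inter> B) dvd p ^ k" "subgroup_index G B (A \<inter> B) dvd p ^ k"
      unfolding k[symmetric] by simp_all
    then obtain i j where "subgroup_index G A (A \<inter> B) = p ^ i" "subgroup_index G B (A \<inter> B) = p ^ j"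
      using divides_primepow_nat[OF assms(2)] by blast
    then have "card A = p ^ i * card (A \<inter> B)" "card B = p ^ j * card (A \<inter> B)" using a b by simp_all
    then show "(\<exists>i. card A = p ^ i * card (A \<inter> B)) \<and> (\<exists>j. card B = p ^ j * card (A \<inter> B))" by blast
  next
    assume "(\<exists>i. card A = p ^ i * card (A \<inter> B)) \<and> (\<exists>j. card B = p ^ j * card (A \<inter> B))"
    then obtain i j where "card A = p ^ i * card (A \<inter> B)" "card B = p ^ j * card (A \<inter> B)" by blast
    then have "subgroup_index G A (A \<inter> B) = p ^ i" "subgroup_index G B (A \<inter> B) = p ^ j"
      using a b pos by (metis mult_cancel2 less_numeral_extra(3))+
    then have "subgroup_index G A (A \<inter> B) * subgroup_index G B (A \<inter> B) = p ^ (i + j)"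
      by (simp add: power_add)
    then show "p_commensurable p G A B" unfolding p_commensurable_def by blast
  qed
qed

text \<open>Elements of \<open>A\<close> of \<open>q\<close>-power order with \<open>q \<noteq> p\<close> lie in \<open>B\<close> and therefore in \<open>C\<close>, so no prime
other than \<open>p\<close> divides the index of \<open>A \<inter> C\<close> in \<open>A\<close>.\<close>

lemma nilpotent_p_commensurable_card:
  assumes "finite (carrier G)" "nilpotent G" "Factorial_Ring.prime p"
    "subgroup A G" "subgroup B G" "subgroup C G"
    "p_commensurable p G A B" "p_commensurable p G B C"
  shows "\<exists>i. card A = p ^ i * card (A \<inter> C)"
proof -
  have fin: "finite A" "finite B"
    using assms(1,4,5) subgroup.subset[of A G] subgroup.subset[of B G] finite_subset by blast+
  have AB: "subgroup (A \<inter> B) G" using subgroups_Inter_pair[OF assms(4,5)] .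
  have BC: "subgroup (B \<inter> C) G" using subgroups_Inter_pair[OF assms(5,6)] .
  have AC: "subgroup (A \<inter> C) G" using subgroups_Inter_pair[OF assms(4,6)] .
  obtain k where k: "card A = p ^ k * card (A \<inter> B)"
    using assms(7) p_commensurable_iff_card[OF assms(1,3,4,5)] by blast
  obtain l where l: "card B = p ^ l * card (B \<inter> C)"
    using assms(8) p_commensurable_iff_card[OF assms(1,3,5,6)] by blast
  obtain i where i: "card A = i * card (A \<inter> C)"
    using card_subgroup_dvd[OF assms(4) AC] by (auto simp: dvd_def mult.commute)
  have "card A > 0" using fin(1) subgroup.one_closed[OF assms(4)] by (auto simp: card_gt_0_iff)
  then have "i > 0" using i by (cases i) auto
  moreover have "\<not> q dvd i" if q: "Factorial_Ring.prime q" "q \<noteq> p" for q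
  proof (rule prime_not_dvd_index[OF assms(4) AC _ fin(1) q(1) _ i])
    show "A \<inter> p_elements G q \<subseteq> A \<inter> C"
    proof
      fix x assume x: "x \<in> A \<inter> p_elements G q"
      then obtain j where j: "x [^] (q ^ j) = \<one>" unfolding p_elements_def by blast
      have cop: "coprime (q ^ j) p" using q assms(3) by (simp add: primes_coprime)
      have "x \<in> A \<inter> B"
        using nilpotent_p'_elements_mem[OF assms(2,4) fin(1) assms(3) _ j cop AB _ k] x by blast
      then have "x \<in> B \<inter> C"
        using nilpotent_p'_elements_mem[OF assms(2,5) fin(2) assms(3) _ j cop BC _ l] by blast
      then show "x \<in> A \<inter> C" using x by blast
    qed
  qed blast
  ultimately obtain e where "i = p ^ e"
    using prime_power_if_unique_prime_divisor[of i p] assms(3) by blast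
  then show ?thesis using i by blast
qed

lemma nilpotent_p_commensurable_trans:
  assumes "finite (carrier G)" "nilpotent G" "Factorial_Ring.prime p"
    "subgroup A G" "subgroup B G" "subgroup C G"
    "p_commensurable p G A B" "p_commensurable p G B C"
  shows "p_commensurable p G A C"
  unfolding p_commensurable_iff_card[OF assms(1,3,4,6)]
  using nilpotent_p_commensurable_card[OF assms]
    nilpotent_p_commensurable_card[OF assms(1,2,3,6,5,4) p_commensurable_sym[OF assms(8)]
      p_commensurable_sym[OF assms(7)]]
  by (simp add: Int_commute)

end

section \<open>Components of symmetric digraphs\<close>

text \<open>Adding arcs keeps a graph connected, so maximal connected subgraphs are induced subgraphs.\<close>

lemma arc_mono_connected: "arc_mono connected"
  unfolding arc_mono_def
proof (intro allI impI)
  fix H1 H2 :: "('v, 'e) pre_digraph"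
  assume h: "connected H1 \<and> subgraph H1 H2 \<and> verts H1 = verts H2"
  then have sub: "subgraph (mk_symmetric H1) (mk_symmetric H2)" by (intro subgraph_mk_symmetric) blast
  have "strongly_connected (mk_symmetric H1)" using h by (simp add: connected_def)
  then show "connected H2"
    using h pre_digraph.reachable_mono[OF _ sub]
    unfolding connected_def strongly_connected_def by simp
qed

lemma (in wf_digraph) connected_subgraph_reachable:
  assumes "symmetric G" "subgraph H G" "connected H" "u \<in> verts H" "v \<in> verts H"
  shows "u \<rightarrow>\<^sup>* v"
proof -
  have "u \<rightarrow>\<^sup>*\<^bsub>mk_symmetric H\<^esub> v"
    using assms(3,4,5) by (simp add: connected_def strongly_connected_def)
  then have "u \<rightarrow>\<^sup>*\<^bsub>mk_symmetric G\<^esub> v"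
    by (rule pre_digraph.reachable_mono[OF _ subgraph_mk_symmetric[OF assms(2)]])
  then show ?thesis using reachable_mk_symmetric_eq[OF assms(1)] by simp
qed

text \<open>Components are defined as maximal connected subgraphs; this provides one through every vertex.\<close>

lemma (in wf_digraph) reachable_set_max_connected:
  assumes sym: "symmetric G" and u: "u \<in> verts G"
  shows "max_subgraph connected (G \<restriction> {x. u \<rightarrow>\<^sup>* x})"
proof (rule max_subgraphI)
  define S where "S = {x. u \<rightarrow>\<^sup>* x}"
  define C where "C = G \<restriction> S"
  have S: "S \<subseteq> verts G" "u \<in> S" using u by (auto simp: S_def elim: reachable_in_vertsE)
  interpret C: wf_digraph C unfolding C_def by (rule wellformed_induce_subgraph)
  have adj: "x \<rightarrow>\<^bsub>C\<^esub> y \<longleftrightarrow> x \<rightarrow> y \<and> x \<in> S \<and> y \<in> S" for x y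
    by (auto simp: C_def arcs_ends_conv)
  have "symmetric C"
    unfolding symmetric_def sym_def using adj arcs_ends_symmetric[OF sym] by blast
  have from_u: "u \<rightarrow>\<^sup>*\<^bsub>C\<^esub> x" if "u \<rightarrow>\<^sup>* x" for x
    using that
  proof (induction rule: reachable_induct)
    case base
    have "u \<in> verts C" using S(2) by (simp add: C_def)
    then show ?case by (rule C.reachable_refl)
  next
    case (step x y)
    then have "u \<rightarrow>\<^sup>* y" by (metis reachable_adj_trans)
    then have "x \<rightarrow>\<^bsub>C\<^esub> y" using adj step by (simp add: S_def)
    then show ?case using step.IH C.reachable_adj_trans by blast
  qed
  have "strongly_connected (mk_symmetric C)"
  proof
    show "verts (with_proj (mk_symmetric C)) \<noteq> {}" using S(2) by (auto simp: C_def)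
    fix x y assume "x \<in> verts (with_proj (mk_symmetric C))" "y \<in> verts (with_proj (mk_symmetric C))"
    then have "u \<rightarrow>\<^sup>*\<^bsub>C\<^esub> x" "u \<rightarrow>\<^sup>*\<^bsub>C\<^esub> y" using from_u by (auto simp: C_def S_def)
    then have "x \<rightarrow>\<^sup>*\<^bsub>C\<^esub> y"
      using C.reachable_trans symmetric_reachable[OF \<open>symmetric C\<close>] by blast
    then show "x \<rightarrow>\<^sup>*\<^bsub>with_proj (mk_symmetric C)\<^esub> y" by (rule C.reachable_mk_symmetricI)
  qed
  then show "connected (G \<restriction> {x. u \<rightarrow>\<^sup>* x})" by (simp add: connected_def C_def S_def)
  have "induced_subgraph C G" unfolding C_def using S(1) by (rule induced_induce)
  then show "subgraph (G \<restriction> {x. u \<rightarrow>\<^sup>* x}) G"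
    using induced_imp_subgraph by (simp add: C_def S_def)
  fix H assume H: "G \<restriction> {x. u \<rightarrow>\<^sup>* x} \<noteq> H" "subgraph (G \<restriction> {x. u \<rightarrow>\<^sup>* x}) H" "subgraph H G"
  show "\<not> connected H"
  proof
    assume "connected H"
    have CH: "C \<noteq> H" "subgraph C H" using H by (simp_all add: C_def S_def)
    have "u \<in> verts H" using CH(2) S(2) by (auto simp: C_def subgraph_def)
    then have "verts H \<subseteq> S"
      using connected_subgraph_reachable[OF sym H(3) \<open>connected H\<close>] by (auto simp: S_def)
    then have verts: "verts H = verts C" using CH(2) by (auto simp: C_def subgraph_def)
    have H': "wf_digraph H" "arcs H \<subseteq> arcs G" "tail G = tail H" "head G = head H"
      using H(3) by (auto simp: subgraph_def compatible_def)
    then have "arcs H \<subseteq> arcs C"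
      using wf_digraph.tail_in_verts[OF H'(1)] wf_digraph.head_in_verts[OF H'(1)] \<open>verts H \<subseteq> S\<close>
      by (auto simp: C_def)
    then have "arcs H = arcs C" using CH(2) by (auto simp: subgraph_def)
    then have "H = C" using verts H'(3,4) by (simp add: C_def pre_digraph.equality)
    then show False using CH(1) by simp
  qed
qed

text \<open>If adjacency is transitive, walks shorten to single arcs; conversely the ends of a walk of
length two lie in a common component.\<close>

lemma components_complete_iff_trans:
  assumes "pair_bidirected_digraph P"
  shows "(\<forall>C \<in> connected_components (with_proj P). complete_graph C) \<longleftrightarrow>
    (\<forall>u v w. (u, v) \<in> parcs P \<longrightarrow> (v, w) \<in> parcs P \<longrightarrow> u \<noteq> w \<longrightarrow> (u, w) \<in> parcs P)"
    (is "?L \<longleftrightarrow> ?R")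
proof -
  interpret P: pair_bidirected_digraph P by fact
  have sym: "symmetric (with_proj P)" by (rule P.sym_arcs)
  show ?thesis
  proof
    assume ?L
    show ?R
    proof (intro allI impI)
      fix u v w assume uvw: "(u, v) \<in> parcs P" "(v, w) \<in> parcs P" "u \<noteq> w"
      define S where "S = {x. u \<rightarrow>\<^sup>*\<^bsub>with_proj P\<^esub> x}"
      have "u \<in> pverts P" using P.adj_in_verts(1)[of u v] uvw(1) by simp
      then have "with_proj P \<restriction> S \<in> connected_components (with_proj P)"
        using P.reachable_set_max_connected[OF sym] by (simp add: connected_components_def S_def)
      then have "complete_graph (with_proj P \<restriction> S)" using \<open>?L\<close> by blast
      moreover have "u \<in> S" "w \<in> S"
        using uvw P.adj_reachable_trans[of u v w] P.reachable_adjI[of v w] \<open>u \<in> pverts P\<close>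
        by (simp_all add: S_def)
      ultimately have "u \<rightarrow>\<^bsub>with_proj P \<restriction> S\<^esub> w" using uvw(3) by (simp add: complete_graph_def)
      then show "(u, w) \<in> parcs P" using dominates_induce_subgraphD by fastforce
    qed
  next
    assume ?R
    show ?L
    proof
      fix C assume "C \<in> connected_components (with_proj P)"
      then have max: "pre_digraph.max_subgraph (with_proj P) connected C"
        by (simp add: connected_components_def)
      have C: "subgraph C (with_proj P)" "connected C"
        using max by (auto simp: pre_digraph.max_subgraph_def)
      have ind: "induced_subgraph C (with_proj P)"
        by (rule pre_digraph.induced_subgraphI_arc_mono[OF max arc_mono_connected])
      show "complete_graph C"
        unfolding complete_graph_def
      proof (intro ballI impI)
        fix u v assume uv: "u \<in> verts C" "v \<in> verts C" "u \<noteq> v"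
        have "x = u \<or> (u, x) \<in> parcs P" if "u \<rightarrow>\<^sup>*\<^bsub>with_proj P\<^esub> x" for x
          using that
        proof (induction rule: P.reachable_induct)
          case (step x y)
          then show ?case using \<open>?R\<close> by auto
        qed simp
        then have "(u, v) \<in> parcs P"
          using P.connected_subgraph_reachable[OF sym C uv(1,2)] uv(3) by blast
        then have arc: "(u, v) \<in> arcs C" using ind uv by (simp add: induced_subgraph_def)
        have "tail C = fst" "head C = snd" using C(1) by (auto simp: subgraph_def compatible_def)
        then show "u \<rightarrow>\<^bsub>C\<^esub> v" using arc by (force simp: arcs_ends_conv)
      qed
    qed
  qed
qed

lemma (in group) p_commensurable_refl:
  assumes "subgroup A G"
  shows "p_commensurable p G A A"
proof -
  interpret A: subgroup A G by fact
  have "A #> a = A" if "a \<in> A" for a using that by (rule A.rcos_const[OF is_group])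
  moreover have "A \<noteq> {}" using A.one_closed by blast
  ultimately have "rcosets\<^bsub>G\<lparr>carrier := A\<rparr>\<^esub> A = {A}" by (simp add: RCOSETS_def)
  then have "subgroup_index G A (A \<inter> A) * subgroup_index G A (A \<inter> A) = p ^ 0"
    by (simp add: subgroup_index_def)
  then show ?thesis unfolding p_commensurable_def by blast
qed

lemma (in group) components_complete_iff_p_commensurable_trans:
  "(\<forall>C \<in> connected_components (with_proj (local_comm_graph p G)). complete_graph C) \<longleftrightarrow>
    (\<forall>A \<in> finite_index_subgroups G. \<forall>B \<in> finite_index_subgroups G.
      \<forall>C \<in> finite_index_subgroups G.
        p_commensurable p G A B \<longrightarrow> p_commensurable p G B C \<longrightarrow> p_commensurable p G A C)"
proof -
  have arc: "(A, B) \<in> parcs (local_comm_graph p G) \<longleftrightarrow> A \<in> finite_index_subgroups G \<and>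
      B \<in> finite_index_subgroups G \<and> A \<noteq> B \<and> p_commensurable p G A B" for A B
    by (simp add: local_comm_graph_def p_commensurable_def)
  have refl: "p_commensurable p G A A" if "A \<in> finite_index_subgroups G" for A
    using that by (simp add: finite_index_subgroups_def p_commensurable_refl)
  show ?thesis
    unfolding components_complete_iff_trans[OF local_comm_graph_bidirected] arc
  proof (intro iffI ballI allI impI)
    fix A B C
    assume trans: "\<forall>u v w. u \<in> finite_index_subgroups G \<and> v \<in> finite_index_subgroups G \<and> u \<noteq> v \<and>
        p_commensurable p G u v \<longrightarrow> v \<in> finite_index_subgroups G \<and> w \<in> finite_index_subgroups G \<and>
        v \<noteq> w \<and> p_commensurable p G v w \<longrightarrow> u \<noteq> w \<longrightarrow> u \<in> finite_index_subgroups G \<and>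
        w \<in> finite_index_subgroups G \<and> u \<noteq> w \<and> p_commensurable p G u w"
      and ABC: "A \<in> finite_index_subgroups G" "B \<in> finite_index_subgroups G"
        "C \<in> finite_index_subgroups G" "p_commensurable p G A B" "p_commensurable p G B C"
    show "p_commensurable p G A C"
    proof (cases "A = B \<or> B = C \<or> A = C")
      case True
      then show ?thesis using ABC refl[OF ABC(1)] by blast
    next
      case False
      then show ?thesis using trans ABC by blast
    qed
  qed blast
qed

section \<open>Passing to finite quotients\<close>

context group_hom
begin

lemma image_r_coset:
  assumes "B \<subseteq> carrier G" "a \<in> carrier G"
  shows "h ` (B #>\<^bsub>G\<^esub> a) = h ` B #>\<^bsub>H\<^esub> h a"
proof -
  have "h (b \<otimes>\<^bsub>G\<^esub> a) = h b \<otimes>\<^bsub>H\<^esub> h a" if "b \<in> B" for b using that assms by (simp add: subset_iff)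
  then show ?thesis unfolding r_coset_def by (auto simp: image_iff) 
qed

text \<open>The correspondence theorem on the level of cosets: a subgroup containing the kernel is
recovered from its image, and so are its cosets. It also covers infinite groups, where indices
are not quotients of orders.\<close>

lemma bij_betw_rcosets_image:
  assumes A: "subgroup A G" and B: "subgroup B G" "B \<subseteq> A" and ker: "kernel G H h \<subseteq> B"
  shows "bij_betw (image h) (rcosets\<^bsub>G\<lparr>carrier := A\<rparr>\<^esub> B) (rcosets\<^bsub>H\<lparr>carrier := h ` A\<rparr>\<^esub> (h ` B))"
proof -
  have sub: "A \<subseteq> carrier G" "B \<subseteq> carrier G" using A B(1) by (simp_all add: subgroup.subset)
  have "inj_on (image h) (rcosets\<^bsub>G\<lparr>carrier := A\<rparr>\<^esub> B)"
  proof (rule inj_onI)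
    fix R1 R2 assume R: "R1 \<in> rcosets\<^bsub>G\<lparr>carrier := A\<rparr>\<^esub> B" "R2 \<in> rcosets\<^bsub>G\<lparr>carrier := A\<rparr>\<^esub> B" "h ` R1 = h ` R2"
    then obtain a b where ab: "a \<in> A" "b \<in> A" "R1 = B #>\<^bsub>G\<^esub> a" "R2 = B #>\<^bsub>G\<^esub> b"
      by (auto simp: RCOSETS_def r_coset_def)
    have abG: "a \<in> carrier G" "b \<in> carrier G" using ab sub by blast+
    have "a \<in> R1" using ab(3) G.rcos_self[OF abG(1) B(1)] by simp
    then have "h a \<in> h ` R2" using R(3) by blast
    then obtain c where c: "c \<in> B" "h a = h (c \<otimes>\<^bsub>G\<^esub> b)" unfolding ab(4) r_coset_def by auto
    have cG: "c \<in> carrier G" using c sub by blast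
    have "h (a \<otimes>\<^bsub>G\<^esub> inv\<^bsub>G\<^esub> (c \<otimes>\<^bsub>G\<^esub> b)) = h (c \<otimes>\<^bsub>G\<^esub> b) \<otimes>\<^bsub>H\<^esub> inv\<^bsub>H\<^esub> h (c \<otimes>\<^bsub>G\<^esub> b)"
      unfolding c(2)[symmetric] using abG cG c(2) by (simp del: hom_mult add: hom_mult[of a "inv\<^bsub>G\<^esub> (c \<otimes>\<^bsub>G\<^esub> b)"])
    then have "a \<otimes>\<^bsub>G\<^esub> inv\<^bsub>G\<^esub> (c \<otimes>\<^bsub>G\<^esub> b) \<in> kernel G H h" using abG cG by (simp add: kernel_def)
    then have "a \<otimes>\<^bsub>G\<^esub> inv\<^bsub>G\<^esub> (c \<otimes>\<^bsub>G\<^esub> b) \<in> B" using ker by blast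
    then have "a \<otimes>\<^bsub>G\<^esub> inv\<^bsub>G\<^esub> (c \<otimes>\<^bsub>G\<^esub> b) \<otimes>\<^bsub>G\<^esub> c \<in> B" using c(1) B(1) by (simp add: subgroup.m_closed)
    then have "a \<otimes>\<^bsub>G\<^esub> inv\<^bsub>G\<^esub> b \<in> B" using abG cG by (simp add: G.inv_mult_group G.m_assoc)
    then have "a \<in> B #>\<^bsub>G\<^esub> b" using subgroup.rcos_module_rev[OF B(1) G.is_group abG(2,1)] by blast
    then show "R1 = R2" unfolding ab(3,4) using G.repr_independence[OF _ abG(2) B(1)] by simp
  qed
  moreover have "image h ` (rcosets\<^bsub>G\<lparr>carrier := A\<rparr>\<^esub> B) = rcosets\<^bsub>H\<lparr>carrier := h ` A\<rparr>\<^esub> (h ` B)"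
  proof -
    have eq: "h ` (B #>\<^bsub>G\<^esub> a) = h ` B #>\<^bsub>H\<^esub> h a" if "a \<in> A" for a
      using image_r_coset[OF sub(2)] that sub(1) by blast
    have 1: "rcosets\<^bsub>G\<lparr>carrier := A\<rparr>\<^esub> B = (\<lambda>a. B #>\<^bsub>G\<^esub> a) ` A" by (auto simp: RCOSETS_def)
    have 2: "rcosets\<^bsub>H\<lparr>carrier := h ` A\<rparr>\<^esub> (h ` B) = (\<lambda>a. h ` B #>\<^bsub>H\<^esub> h a) ` A" by (auto simp: RCOSETS_def)
    show ?thesis unfolding 1 2 image_image using eq by (rule image_cong[OF refl])
  qed
  ultimately show ?thesis by (simp add: bij_betw_def)
qed

lemma image_Int_supset_kernel:
  assumes "subgroup A G" "subgroup B G" "kernel G H h \<subseteq> B"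
  shows "h ` (A \<inter> B) = h ` A \<inter> h ` B"
proof (intro equalityI subsetI)
  fix y assume "y \<in> h ` A \<inter> h ` B"
  then obtain a b where ab: "a \<in> A" "b \<in> B" "y = h a" "h a = h b" by auto
  have abG: "a \<in> carrier G" "b \<in> carrier G" using ab assms by (simp_all add: subgroup.mem_carrier)
  then have "a \<otimes>\<^bsub>G\<^esub> inv\<^bsub>G\<^esub> b \<in> kernel G H h" using ab(4) by (simp add: kernel_def)
  then have "a \<otimes>\<^bsub>G\<^esub> inv\<^bsub>G\<^esub> b \<otimes>\<^bsub>G\<^esub> b \<in> B" using subgroup.m_closed[OF assms(2) _ ab(2)] assms(3) by blast
  then have "a \<in> B" using abG by (simp add: G.m_assoc)
  then show "y \<in> h ` (A \<inter> B)" using ab by blast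
qed blast

lemma p_commensurable_image_iff:
  assumes "subgroup A G" "subgroup B G" "kernel G H h \<subseteq> A \<inter> B"
  shows "p_commensurable p H (h ` A) (h ` B) \<longleftrightarrow> p_commensurable p G A B"
proof -
  have I: "subgroup (A \<inter> B) G" using G.subgroups_Inter_pair[OF assms(1,2)] .
  have Int: "h ` A \<inter> h ` B = h ` (A \<inter> B)" using image_Int_supset_kernel[OF assms(1,2)] assms(3) by simp
  have "subgroup_index H (h ` A) (h ` (A \<inter> B)) = subgroup_index G A (A \<inter> B)"
    using bij_betw_same_card[OF bij_betw_rcosets_image[OF assms(1) I _ assms(3)]] by (simp add: subgroup_index_def)
  moreover have "subgroup_index H (h ` B) (h ` (A \<inter> B)) = subgroup_index G B (A \<inter> B)"
    using bij_betw_same_card[OF bij_betw_rcosets_image[OF assms(2) I _ assms(3)]] by (simp add: subgroup_index_def)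
  ultimately show ?thesis unfolding p_commensurable_def Int by simp
qed

lemma finite_rcosets_preimage:
  assumes surj: "h ` carrier G = carrier H" and "finite (carrier H)" "subgroup A G" "kernel G H h \<subseteq> A"
  shows "finite (rcosets\<^bsub>G\<^esub> A)"
proof -
  have "bij_betw (image h) (rcosets\<^bsub>G\<^esub> A) (rcosets\<^bsub>H\<^esub> (h ` A))"
    using bij_betw_rcosets_image[OF G.subgroup_self assms(3) subgroup.subset[OF assms(3)] assms(4)]
    unfolding surj by simp
  moreover have "finite (rcosets\<^bsub>H\<^esub> (h ` A))" using assms(2) by (simp add: RCOSETS_def)
  ultimately show ?thesis using bij_betw_finite by blast
qed

end

context group
begin

lemma finite_index_Int:
  assumes "A \<in> finite_index_subgroups G" "B \<in> finite_index_subgroups G"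
  shows "A \<inter> B \<in> finite_index_subgroups G"
proof -
  have AB: "subgroup A G" "subgroup B G" "finite (rcosets A)" "finite (rcosets B)"
    using assms by (auto simp: finite_index_subgroups_def)
  have I: "subgroup (A \<inter> B) G" using subgroups_Inter_pair[OF AB(1,2)] .
  have "(A \<inter> B) #> x = (A #> x) \<inter> (B #> x)" if x: "x \<in> carrier G" for x
  proof -
    have "inj_on (\<lambda>a. a \<otimes> x) (carrier G)" using x by (auto simp: inj_on_def)
    moreover have "C #> x = (\<lambda>a. a \<otimes> x) ` C" for C by (auto simp: r_coset_def)
    ultimately show ?thesis
      using inj_on_image_Int[of "\<lambda>a. a \<otimes> x" "carrier G" A B] subgroup.subset[OF AB(1)] subgroup.subset[OF AB(2)]
      by simp
  qed
  then have "rcosets (A \<inter> B) \<subseteq> (\<lambda>(X1, X2). X1 \<inter> X2) ` ((rcosets A) \<times> (rcosets B))"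
    by (auto simp: RCOSETS_def)
  then have "finite (rcosets (A \<inter> B))" using AB(3,4) by (meson finite_SigmaI finite_imageI finite_subset)
  then show ?thesis using I by (simp add: finite_index_subgroups_def)
qed

text \<open>The normal core \<open>N\<close> of \<open>A\<close> is the kernel of the action on the cosets of \<open>A\<close> by right
multiplication. The coset \<open>N #> x\<close> is determined by the permutation that \<open>x\<close> induces, and there
are only finitely many of these.\<close>

lemma finite_index_normal_core:
  assumes "A \<in> finite_index_subgroups G"
  obtains N where "N \<lhd> G" "N \<subseteq> A" "finite (carrier (G Mod N))"
proof -
  have A: "subgroup A G" "finite (rcosets A)" using assms by (auto simp: finite_index_subgroups_def)
  interpret A: subgroup A G by (rule A(1))
  define N where "N = {n \<in> carrier G. \<forall>g \<in> carrier G. g \<otimes> n \<otimes> inv g \<in> A}"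
  have sub: "subgroup N G"
  proof
    show "N \<subseteq> carrier G" "\<one> \<in> N" by (auto simp: N_def)
    fix x y assume xy: "x \<in> N" "y \<in> N"
    then have G: "x \<in> carrier G" "y \<in> carrier G" by (auto simp: N_def)
    have "g \<otimes> (x \<otimes> y) \<otimes> inv g \<in> A" if g: "g \<in> carrier G" for g
    proof -
      have "(g \<otimes> x \<otimes> inv g) \<otimes> (g \<otimes> y \<otimes> inv g) \<in> A" using xy g by (simp add: N_def)
      then show ?thesis using G g by (simp add: m_assoc)
    qed
    then show "x \<otimes> y \<in> N" using G by (simp add: N_def)
  next
    fix x assume x: "x \<in> N"
    then have G: "x \<in> carrier G" by (auto simp: N_def)
    have "g \<otimes> inv x \<otimes> inv g \<in> A" if g: "g \<in> carrier G" for g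
    proof -
      have "inv (g \<otimes> x \<otimes> inv g) \<in> A" using x g by (simp add: N_def)
      then show ?thesis using G g by (simp add: m_assoc inv_mult_group)
    qed
    then show "inv x \<in> N" using G by (simp add: N_def)
  qed
  have "N \<lhd> G"
    unfolding normal_inv_iff
  proof (intro conjI ballI sub)
    fix x n assume x: "x \<in> carrier G" and n: "n \<in> N"
    then have nG: "n \<in> carrier G" by (auto simp: N_def)
    have "g \<otimes> (x \<otimes> n \<otimes> inv x) \<otimes> inv g \<in> A" if g: "g \<in> carrier G" for g
    proof -
      have "(g \<otimes> x) \<otimes> n \<otimes> inv (g \<otimes> x) \<in> A" using n x g by (simp add: N_def)
      then show ?thesis using nG x g by (simp add: m_assoc inv_mult_group)
    qed
    then show "x \<otimes> n \<otimes> inv x \<in> N" using nG x by (simp add: N_def)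
  qed
  moreover have "N \<subseteq> A"
  proof
    fix n assume "n \<in> N"
    then have "n \<in> carrier G" "\<one> \<otimes> n \<otimes> inv \<one> \<in> A" unfolding N_def by blast+
    then show "n \<in> A" by simp
  qed
  moreover have "finite (carrier (G Mod N))"
  proof -
    \<comment> \<open>restricted to the cosets of \<open>A\<close> so that it takes its values in a finite function space\<close>
    define \<phi> where "\<phi> x = (\<lambda>R \<in> rcosets A. R #> x)" for x
    have "\<phi> x \<in> rcosets A \<rightarrow>\<^sub>E rcosets A" if "x \<in> carrier G" for x
      using that A.subset by (auto simp: \<phi>_def RCOSETS_def coset_mult_assoc)
    then have fin: "finite (\<phi> ` carrier G)"
      using finite_PiE[of "rcosets A" "\<lambda>_. rcosets A"] A(2) by (meson finite_subset image_subsetI)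
    have eq: "N #> x = N #> y" if xy: "x \<in> carrier G" "y \<in> carrier G" "\<phi> x = \<phi> y" for x y
    proof -
      have "g \<otimes> (x \<otimes> inv y) \<otimes> inv g \<in> A" if g: "g \<in> carrier G" for g
      proof -
        have R: "A #> g \<in> rcosets A" using g A.subset by (simp add: rcosetsI)
        have "A #> g #> x = A #> g #> y" using fun_cong[OF xy(3), of "A #> g"] R by (simp add: \<phi>_def)
        then have "A #> (g \<otimes> x) = A #> (g \<otimes> y)" using xy g A.subset by (simp add: coset_mult_assoc)
        moreover have "g \<otimes> x \<in> A #> (g \<otimes> x)" using xy g by (intro rcos_self A(1)) simp
        ultimately have "g \<otimes> x \<in> A #> (g \<otimes> y)" by simp
        then have "(g \<otimes> x) \<otimes> inv (g \<otimes> y) \<in> A"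
          using A.rcos_module_imp[OF is_group, of "g \<otimes> y"] xy g by simp
        then show ?thesis using xy g by (simp add: m_assoc inv_mult_group)
      qed
      then have "x \<otimes> inv y \<in> N" using xy by (simp add: N_def)
      then have "x \<in> N #> y" using subgroup.rcos_module_rev[OF sub is_group xy(2,1)] by blast
      then show ?thesis using repr_independence[OF _ xy(2) sub] by simp
    qed
    have "N #> x = N #> inv_into (carrier G) \<phi> (\<phi> x)" if x: "x \<in> carrier G" for x
      using eq[OF x] inv_into_into[of "\<phi> x" \<phi> "carrier G"] f_inv_into_f[of "\<phi> x" \<phi> "carrier G"] x by simp
    then have "carrier (G Mod N) \<subseteq> (\<lambda>f. N #> inv_into (carrier G) \<phi> f) ` \<phi> ` carrier G"
      unfolding carrier_FactGroup by blast
    then show ?thesis using fin finite_subset by blast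
  qed
  ultimately show thesis by (rule that)
qed

end

lemma kernel_quotient:
  assumes "N \<lhd> G"
  shows "kernel G (G Mod N) (\<lambda>x. N #>\<^bsub>G\<^esub> x) = N"
proof -
  interpret N: normal N G by fact
  show ?thesis
    using N.rcos_const[OF N.is_group] N.rcos_self[OF _ N.subgroup_axioms] N.mem_carrier
    by (auto simp: kernel_def)
qed

text \<open>For \<open>A, B \<subseteq> C\<close> of \<open>p\<close>-power index, both are \<open>p\<close>-commensurable with \<open>C\<close>, hence so are their
preimages, and transitivity applies to the preimages of \<open>A\<close>, \<open>C\<close>, \<open>B\<close>.\<close>

lemma (in group_hom) p_index_closed_image:
  assumes surj: "h ` carrier G = carrier H" and fin: "finite (carrier H)"
    and trans: "\<And>p A B C. Factorial_Ring.prime p \<Longrightarrow> A \<in> finite_index_subgroups G \<Longrightarrow>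
      B \<in> finite_index_subgroups G \<Longrightarrow> C \<in> finite_index_subgroups G \<Longrightarrow>
      p_commensurable p G A B \<Longrightarrow> p_commensurable p G B C \<Longrightarrow> p_commensurable p G A C"
  shows "p_index_closed H"
  unfolding p_index_closed_def
proof (intro allI impI)
  fix p :: nat and A B C
  assume p: "Factorial_Ring.prime p"
    and sub: "subgroup A H" "subgroup B H" "subgroup C H" "A \<subseteq> C" "B \<subseteq> C"
    and "\<exists>a. card C = p ^ a * card A" "\<exists>b. card C = p ^ b * card B"
  then obtain a b where ab: "card C = p ^ a * card A" "card C = p ^ b * card B" by blast
  define pre where "pre X1 = {x \<in> carrier G. h x \<in> X1}" for X1
  have pre: "pre X1 \<in> finite_index_subgroups G" "subgroup (pre X1) G" "kernel G H h \<subseteq> pre X1"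
    "h ` pre X1 = X1" if X1: "subgroup X1 H" for X1
  proof -
    show s: "subgroup (pre X1) G" unfolding pre_def by (rule subgroup_preimage[OF X1])
    show k: "kernel G H h \<subseteq> pre X1"
      using subgroup.one_closed[OF X1] by (auto simp: kernel_def pre_def)
    show "pre X1 \<in> finite_index_subgroups G"
      using s finite_rcosets_preimage[OF surj fin s k] by (simp add: finite_index_subgroups_def)
    show "h ` pre X1 = X1" using subgroup.subset[OF X1] surj by (auto simp: pre_def)
  qed
  have iff: "p_commensurable p G (pre X1) (pre X2) \<longleftrightarrow> p_commensurable p H X1 X2"
    if "subgroup X1 H" "subgroup X2 H" for X1 X2
    using p_commensurable_image_iff[OF pre(2)[OF that(1)] pre(2)[OF that(2)], of p]
      pre(3,4)[OF that(1)] pre(3,4)[OF that(2)] by simp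
  have "A \<inter> C = A" "C \<inter> B = B" using sub(4,5) by blast+
  moreover have "card A = p ^ 0 * card A" "card B = p ^ 0 * card B" by simp_all
  ultimately have "p_commensurable p H A C" "p_commensurable p H C B"
    using ab H.p_commensurable_iff_card[OF fin p sub(1,3)] H.p_commensurable_iff_card[OF fin p sub(3,2)]
    by (metis)+
  then have "p_commensurable p H A B"
    using trans[OF p pre(1)[OF sub(1)] pre(1)[OF sub(3)] pre(1)[OF sub(2)]]
      iff[OF sub(1,3)] iff[OF sub(3,2)] iff[OF sub(1,2)] by blast
  then obtain i where "card A = p ^ i * card (A \<inter> B)"
    using H.p_commensurable_iff_card[OF fin p sub(1,2)] by blast
  then have "card C = p ^ (a + i) * card (A \<inter> B)" using ab(1) by (simp add: power_add)
  then show "\<exists>k. card C = p ^ k * card (A \<inter> B)" by blast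
qed

lemma (in group) p_commensurable_trans_if_nilpotent_quotients:
  assumes nilp: "\<And>N. N \<lhd> G \<Longrightarrow> finite (carrier (G Mod N)) \<Longrightarrow> nilpotent (G Mod N)"
    and p: "Factorial_Ring.prime p"
    and fi: "A \<in> finite_index_subgroups G" "B \<in> finite_index_subgroups G"
      "C \<in> finite_index_subgroups G"
    and AB: "p_commensurable p G A B" and BC: "p_commensurable p G B C"
  shows "p_commensurable p G A C"
proof -
  obtain N where N: "N \<lhd> G" "N \<subseteq> A \<inter> B \<inter> C" "finite (carrier (G Mod N))"
    using finite_index_normal_core[OF finite_index_Int[OF finite_index_Int[OF fi(1,2)] fi(3)]] .
  interpret q: group_hom G "G Mod N" "\<lambda>x. N #> x" by (rule quotient_hom[OF N(1)])
  have sub: "subgroup A G" "subgroup B G" "subgroup C G"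
    using fi by (auto simp: finite_index_subgroups_def)
  have iff: "p_commensurable p (G Mod N) ((#>) N ` X1) ((#>) N ` X2) \<longleftrightarrow> p_commensurable p G X1 X2"
    if "subgroup X1 G" "subgroup X2 G" "N \<subseteq> X1 \<inter> X2" for X1 X2
    using q.p_commensurable_image_iff[OF that(1,2)] that(3) kernel_quotient[OF N(1)] by simp
  have "p_commensurable p (G Mod N) ((#>) N ` A) ((#>) N ` C)"
  proof (rule q.H.nilpotent_p_commensurable_trans[OF N(3) nilp[OF N(1,3)] p])
    show "p_commensurable p (G Mod N) ((#>) N ` A) ((#>) N ` B)"
      using iff[OF sub(1,2)] AB N(2) by blast
    show "p_commensurable p (G Mod N) ((#>) N ` B) ((#>) N ` C)"
      using iff[OF sub(2,3)] BC N(2) by blast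
  qed (rule q.subgroup_img_is_subgroup, rule sub)+
  then show ?thesis using iff[OF sub(1,3)] N(2) by blast
qed

theorem theorem1:
  fixes G :: "('a, 'b) monoid_scheme"
  assumes "group G"
  shows "(\<forall>p::nat. Factorial_Ring.prime p \<longrightarrow>
            (\<forall>C \<in> connected_components (with_proj (local_comm_graph p G)). complete_graph C))
     \<longleftrightarrow> (\<forall>N. N \<lhd> G \<and> finite (carrier (G Mod N)) \<longrightarrow> nilpotent (G Mod N))"
proof -
  interpret group G by fact
  show ?thesis
    unfolding components_complete_iff_p_commensurable_trans
  proof (intro iffI allI impI ballI)
    fix N
    assume trans: "\<forall>p. Factorial_Ring.prime p \<longrightarrow> (\<forall>A \<in> finite_index_subgroups G.
        \<forall>B \<in> finite_index_subgroups G. \<forall>C \<in> finite_index_subgroups G.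
        p_commensurable p G A B \<longrightarrow> p_commensurable p G B C \<longrightarrow> p_commensurable p G A C)"
      and "N \<lhd> G \<and> finite (carrier (G Mod N))"
    then have N: "N \<lhd> G" "finite (carrier (G Mod N))" by simp_all
    interpret q: group_hom G "G Mod N" "\<lambda>x. N #>\<^bsub>G\<^esub> x" by (rule quotient_hom[OF N(1)])
    have "p_index_closed (G Mod N)"
    proof (rule q.p_index_closed_image[OF _ N(2)])
      show "(\<lambda>x. N #>\<^bsub>G\<^esub> x) ` carrier G = carrier (G Mod N)" by (simp add: carrier_FactGroup)
    qed (rule trans[rule_format])
    then have "normalizer_condition (G Mod N) (carrier (G Mod N))"
      by (rule p_index_closed_imp_normalizer_condition[OF q.H.is_group N(2)])
    then show "nilpotent (G Mod N)"
      by (rule q.H.normalizer_condition_imp_nilpotent[OF N(2)])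
  next
    fix p A B C
    assume "\<forall>N. N \<lhd> G \<and> finite (carrier (G Mod N)) \<longrightarrow> nilpotent (G Mod N)"
      and "Factorial_Ring.prime p" "A \<in> finite_index_subgroups G" "B \<in> finite_index_subgroups G"
        "C \<in> finite_index_subgroups G" "p_commensurable p G A B" "p_commensurable p G B C"
    then show "p_commensurable p G A C"
      by (intro p_commensurable_trans_if_nilpotent_quotients[of p A B C]) simp_all
  qed
qed

end
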